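(* Let $1\leq l\leq p$. Then for every $\epsilon>0$, \[ \mathbb{E}\left[Z-(1+\epsilon)\mathbb{E} Z\right]_+^l\leq\left(\left(\frac{64}{\epsilon}+7+\epsilon\right)\frac{lM}{n^{1-\frac{l}{p}}}+\frac{4\sqrt{l}\,\sigma}{\sqrt n}\right)^l, \] and, if additionally $\epsilon\in(0,1]$, \[ \mathbb{E}\left[(1-\epsilon)\mathbb{E} Z-Z\right]_+^l\leq\left(\left(\frac{86.4}{\epsilon}+7-\epsilon\right)\frac{lM}{n^{1-\frac{l}{p}}}+\frac{4.7\sqrt{l}\,\sigma}{\sqrt n}\right)^l. \]
   Context: Let $n,N$ be positive integers and $\mathcal{Z}_1,\dots,\mathcal{Z}_n$ probability spaces; all random variables below live on the product space $\mathcal{Z}_1\times\dots\times\mathcal{Z}_n$ with the product measure. For $1\leq i\leq n$ and $1\leq j\leq N$ let $Z_i(j):\mathcal{Z}_i\to\mathbb{R}$ be random variables (so the families $(Z_i(j))_{1\le j\le N}$ are independent across $i$; they need not be identically distributed), and write $\mathbb{P}_nZ(j):=\frac1n\sum_{i=1}^n Z_i(j)$ and $Z:=\max_{1\leq j\leq N}|\mathbb{P}_nZ(j)|$. An envelope is a collection of random variables $\mathcal{E}_i:\mathcal{Z}_i\to\mathbb{R}$ with $|Z_i(j)|\leq\mathcal{E}_i$ for all $i,j$. Assume there are $p\in[1,\infty)$ and $M>0$ with $\mathbb{E}\mathcal{E}_i^p\leq M^p$ for all $1\leq i\leq n$. Let $\sigma:=\sqrt{\max_{1\leq j\leq N}\frac1n\sum_{i=1}^n\mathbb{E}Z_i(j)^2}$.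 Notation: $(x)_+^l:=(\max\{0,x\})^l$. *)

theory Defs
  imports "HOL-Probability.Probability"
begin

definition PnZ :: "(nat \<Rightarrow> nat \<Rightarrow> 'a \<Rightarrow> real) \<Rightarrow> nat \<Rightarrow> nat \<Rightarrow> (nat \<Rightarrow> 'a) \<Rightarrow> real" where
  "PnZ Zf n j w = (1 / real n) * (\<Sum>i\<in>{1..n}. Zf i j (w i))"

definition Zmax :: "(nat \<Rightarrow> nat \<Rightarrow> 'a \<Rightarrow> real) \<Rightarrow> nat \<Rightarrow> nat \<Rightarrow> (nat \<Rightarrow> 'a) \<Rightarrow> real" where
  "Zmax Zf n N w = Max ((\<lambda>j. \<bar>PnZ Zf n j w\<bar>) ` {1..N})"

definition pos_pow :: "real \<Rightarrow> real \<Rightarrow> real" where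
  "pos_pow x l = (max 0 x) powr l"

text \<open>sigma^2 = max_j (1/n) sum_i E[Z_i(j)^2], as an extended nonnegative real
  (it may be infinite).\<close>
definition sigma_sq :: "(nat \<Rightarrow> 'a measure) \<Rightarrow> (nat \<Rightarrow> nat \<Rightarrow> 'a \<Rightarrow> real) \<Rightarrow> nat \<Rightarrow> nat \<Rightarrow> ennreal" where
  "sigma_sq M Zf n N = Max ((\<lambda>j. ennreal (1 / real n) *
      (\<Sum>i\<in>{1..n}. \<integral>\<^sup>+ x. ennreal ((Zf i j x)\<^sup>2) \<partial>(M i))) ` {1..N})"

end

theory Submission
  imports Defs
begin

text \<open>
  Truncate the envelopes at the level \<open>K = Mb * n powr (l / p)\<close>. The truncated-away part has \<open>l\<close>-norm at
  most \<open>b = K / n = Mb / n powr (1 - l / p)\<close>, by convexity and the moment assumption, and it enters through Minkowski's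
  inequality. The truncated maximum \<open>Z\<close> is a maximum of sums of independent terms bounded by \<open>b\<close>. By
  tensorisation of entropy, applied to \<open>exp (t * Z)\<close> with \<open>t\<close> of either sign,
  \<open>Ent (exp (t * Z)) \<le> 9/8 * t\<^sup>2 * (8 * b * E[exp (t * Z) * (Z + E Z)] + v * E[exp (t * Z)])\<close>, where \<open>v = \<sigma>\<^sup>2 / n\<close>.
  Herbst's argument turns this into a bound on the moment generating function, in which the terms with \<open>E Z\<close> are
  absorbed by \<open>\<epsilon> * E Z\<close>. The \<open>l\<close>-th moment then follows from \<open>x powr l \<le> (l / (exp 1 * t)) powr l * exp (t * x)\<close>
  with \<open>1 / t\<close> equal to twice the claimed bound divided by \<open>l\<close>.
\<close>

section \<open>Tensorisation of entropy\<close>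

text \<open>The summands are not centred, so the one-coordinate entropies carry the means of the
  summands at the maximiser. Minus the sum of these means is at most \<open>E Z\<close>, because the
  family of sums, with a sign attached to each index, is closed under negation. This is why
  \<open>Z + E Z\<close> appears, and why \<open>v\<close> is built from second moments rather than
  variances. The maximiser moves with the coordinate being resampled, so it cannot be frozen inside
  a one-coordinate entropy; this is the main obstacle of the bounded case. The coefficient 8 * 9/8 =
  9 then acts twice, once through the integral of \<open>exp (t * Z) * Z\<close> and once through
  \<open>E Z\<close>. Absorption by \<open>\<epsilon> * E Z\<close> hence asks for roughly 18 * t *
  b \<le> \<epsilon>, which is the origin of the 1/\<epsilon> in the bounds. The summand 5 beside
  64/\<epsilon> enforces t * b \<le> 1/10, and 86.4 enforces t * b \<le> 1/172 for the lower tail.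
  The level \<open>K\<close> is the one at which the bound \<open>K / n\<close> on a truncated
  summand and the l-norm bound of the remainder coincide.\<close>

definition Ent :: "'a measure \<Rightarrow> ('a \<Rightarrow> real) \<Rightarrow> real" where
  "Ent \<mu> f = (\<integral>x. f x * ln (f x) \<partial>\<mu>) - (\<integral>x. f x \<partial>\<mu>) * ln (\<integral>x. f x \<partial>\<mu>)"

lemma abs_mult_ln_le:
  fixes x a B :: real
  assumes "0 < a" "a \<le> x" "x \<le> B"
  shows "\<bar>x * ln x\<bar> \<le> B * (\<bar>ln a\<bar> + \<bar>ln B\<bar>)"
proof -
  have "ln a \<le> ln x" "ln x \<le> ln B" using assms by auto
  then have "\<bar>ln x\<bar> \<le> \<bar>ln a\<bar> + \<bar>ln B\<bar>" by linarith
  then show ?thesis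
    using assms by (auto simp: abs_mult intro!: mult_mono)
qed

section \<open>Variational formula and convexity of entropy\<close>

context prob_space
begin

lemma integrable_bounded:
  fixes f :: "'a \<Rightarrow> real"
  assumes "f \<in> borel_measurable M" "\<And>x. x \<in> space M \<Longrightarrow> \<bar>f x\<bar> \<le> B"
  shows "integrable M f"
  using assms by (intro integrable_const_bound[where B=B]) auto

lemma integral_between:
  fixes f :: "'a \<Rightarrow> real"
  assumes "f \<in> borel_measurable M" "\<And>x. x \<in> space M \<Longrightarrow> a \<le> f x" "\<And>x. x \<in> space M \<Longrightarrow> f x \<le> B"
  shows "a \<le> (\<integral>x. f x \<partial>M)" "(\<integral>x. f x \<partial>M) \<le> B"
proof -
  have "integrable M f"
    using assms by (intro integrable_bounded[where B="max \<bar>a\<bar> \<bar>B\<bar>"]) fastforce+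
  then show "a \<le> (\<integral>x. f x \<partial>M)" "(\<integral>x. f x \<partial>M) \<le> B"
    using assms by (auto intro!: integral_ge_const integral_le_const)
qed

text \<open>Gibbs' variational principle: \<open>ln z \<le> z - 1\<close> at
  \<open>z = u F / (U f)\<close>, multiplied by \<open>f\<close>, has a right side that integrates
  to zero. For fixed \<open>u\<close> the lower bound is linear in \<open>f\<close>, and it is
  attained at \<open>u = f\<close>, so entropy is a supremum of linear functionals; convexity rests
  on this. The bounds \<open>a\<close> and \<open>B\<close> keep all logarithms bounded and all
  integrands integrable, and exponentials of bounded functions satisfy them.\<close>

lemma Ent_variational:
  fixes f u :: "'a \<Rightarrow> real"
  assumes f[measurable]: "f \<in> borel_measurable M" and u[measurable]: "u \<in> borel_measurable M"
    and a: "0 < a"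
    and fb: "\<And>x. x \<in> space M \<Longrightarrow> a \<le> f x" "\<And>x. x \<in> space M \<Longrightarrow> f x \<le> B"
    and ub: "\<And>x. x \<in> space M \<Longrightarrow> a \<le> u x" "\<And>x. x \<in> space M \<Longrightarrow> u x \<le> B"
  shows "(\<integral>x. f x * ln (u x) \<partial>M) - (\<integral>x. f x \<partial>M) * ln (\<integral>x. u x \<partial>M) \<le> Ent M f"
proof -
  define F where "F = (\<integral>x. f x \<partial>M)"
  define U where "U = (\<integral>x. u x \<partial>M)"
  have F: "0 < F" and U: "0 < U"
    using integral_between(1)[OF f fb] integral_between(1)[OF u ub] a by (auto simp: F_def U_def)
  have B: "0 < B"
    using a fb not_empty by fastforce
  have lnu: "\<bar>ln (u x)\<bar> \<le> \<bar>ln a\<bar> + \<bar>ln B\<bar>" if "x \<in> space M" for x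
  proof -
    have "ln a \<le> ln (u x)" "ln (u x) \<le> ln B" using ub[OF that] a by auto
    then show ?thesis by linarith
  qed
  have i1: "integrable M f" "integrable M u"
    using fb ub a B by (auto intro!: integrable_bounded[where B=B] simp: abs_le_iff; fastforce)+
  have i2: "integrable M (\<lambda>x. f x * ln (f x))"
    using abs_mult_ln_le[OF a fb] by (intro integrable_bounded) auto
  have "\<bar>f x * ln (u x)\<bar> \<le> B * (\<bar>ln a\<bar> + \<bar>ln B\<bar>)" if "x \<in> space M" for x
    unfolding abs_mult using fb[OF that] lnu[OF that] a B by (intro mult_mono) auto
  then have i3: "integrable M (\<lambda>x. f x * ln (u x))"
    by (intro integrable_bounded) auto
  have "(\<integral>x. f x * ln (u x) - f x * ln U - f x * ln (f x) + f x * ln F \<partial>M)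
      \<le> (\<integral>x. u x * (F / U) - f x \<partial>M)"
  proof (rule integral_mono)
    fix x assume x: "x \<in> space M"
    have p: "0 < f x" "0 < u x" using fb[OF x] ub[OF x] a by auto
    have "ln (u x) - ln U - ln (f x) + ln F = ln (u x * F / (U * f x))"
      using p F U by (simp add: ln_mult ln_div)
    also have "\<dots> \<le> u x * F / (U * f x) - 1"
      using p F U by (intro ln_le_minus_one) auto
    finally have "f x * (ln (u x) - ln U - ln (f x) + ln F) \<le> f x * (u x * F / (U * f x) - 1)"
      using p by (intro mult_left_mono) auto
    then show "f x * ln (u x) - f x * ln U - f x * ln (f x) + f x * ln F \<le> u x * (F / U) - f x"
      using p U by (simp add: algebra_simps)
  qed (use i1 i2 i3 in auto)
  then show ?thesis
    using i1 i2 i3 U by (simp add: Ent_def F_def[symmetric] U_def[symmetric])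
qed

lemma Ent_nonneg:
  assumes f[measurable]: "f \<in> borel_measurable M" and a: "0 < a"
    and fb: "\<And>x. x \<in> space M \<Longrightarrow> a \<le> f x" "\<And>x. x \<in> space M \<Longrightarrow> f x \<le> B"
  shows "0 \<le> Ent M f"
proof -
  have "a \<le> B" using fb not_empty by fastforce
  then show ?thesis
    using Ent_variational[of f "\<lambda>_. a" a B] a fb by (simp add: prob_space)
qed

text \<open>The bound depends on \<open>a\<close> and \<open>B\<close> only, so the entropy of a
  section is an integrable function of the remaining coordinates.\<close>

lemma abs_Ent_le:
  assumes f[measurable]: "f \<in> borel_measurable M" and a: "0 < a"
    and fb: "\<And>x. x \<in> space M \<Longrightarrow> a \<le> f x" "\<And>x. x \<in> space M \<Longrightarrow> f x \<le> B"
  shows "\<bar>Ent M f\<bar> \<le> 2 * (B * (\<bar>ln a\<bar> + \<bar>ln B\<bar>))"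
proof -
  let ?C = "B * (\<bar>ln a\<bar> + \<bar>ln B\<bar>)"
  have "\<bar>f x * ln (f x)\<bar> \<le> ?C" if "x \<in> space M" for x
    using abs_mult_ln_le[OF a fb[OF that]] .
  then have "- ?C \<le> (\<integral>x. f x * ln (f x) \<partial>M)" "(\<integral>x. f x * ln (f x) \<partial>M) \<le> ?C"
    using integral_between[of "\<lambda>x. f x * ln (f x)" "- ?C" ?C] by (force simp: abs_le_iff)+
  moreover have "\<bar>(\<integral>x. f x \<partial>M) * ln (\<integral>x. f x \<partial>M)\<bar> \<le> ?C"
    using integral_between[OF f fb] by (intro abs_mult_ln_le a) auto
  ultimately show ?thesis
    unfolding Ent_def by linarith
qed

end

text \<open>The average \<open>g\<close> of \<open>f\<close> over \<open>y\<close> serves as the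
  test function \<open>u\<close> for every section at once. Integrated over \<open>y\<close>, the
  variational lower bound becomes exactly \<open>Ent \<mu> g\<close> by Fubini.\<close>

lemma Ent_convex:
  fixes f :: "'a \<times> 'b \<Rightarrow> real"
  assumes "prob_space \<mu>" "prob_space \<nu>"
    and f[measurable]: "f \<in> borel_measurable (\<mu> \<Otimes>\<^sub>M \<nu>)" and a: "0 < a"
    and fb: "\<And>x y. x \<in> space \<mu> \<Longrightarrow> y \<in> space \<nu> \<Longrightarrow> a \<le> f (x, y)"
            "\<And>x y. x \<in> space \<mu> \<Longrightarrow> y \<in> space \<nu> \<Longrightarrow> f (x, y) \<le> B"
  shows "Ent \<mu> (\<lambda>x. \<integral>y. f (x, y) \<partial>\<nu>) \<le> (\<integral>y. Ent \<mu> (\<lambda>x. f (x, y)) \<partial>\<nu>)"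
proof -
  interpret \<mu>: prob_space \<mu> by fact
  interpret \<nu>: prob_space \<nu> by fact
  interpret P: pair_prob_space \<mu> \<nu> ..
  have sp: "space (\<mu> \<Otimes>\<^sub>M \<nu>) = space \<mu> \<times> space \<nu>" by (simp add: space_pair_measure)
  define g where "g x = (\<integral>y. f (x, y) \<partial>\<nu>)" for x
  have g[measurable]: "g \<in> borel_measurable \<mu>" unfolding g_def by measurable
  have gb: "a \<le> g x" "g x \<le> B" if "x \<in> space \<mu>" for x
  proof -
    have "(\<lambda>y. f (x, y)) \<in> borel_measurable \<nu>" using that by measurable
    then show "a \<le> g x" "g x \<le> B"
      unfolding g_def using \<nu>.integral_between[of "\<lambda>y. f (x, y)" a B] fb[OF that] by auto
  qed
  have B: "0 < B"
    using a gb \<mu>.not_empty by fastforce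
  have lng: "\<bar>ln (g x)\<bar> \<le> \<bar>ln a\<bar> + \<bar>ln B\<bar>" if "x \<in> space \<mu>" for x
  proof -
    have "ln a \<le> ln (g x)" "ln (g x) \<le> ln B" using gb[OF that] a by auto
    then show ?thesis by linarith
  qed
  have if1: "integrable (\<mu> \<Otimes>\<^sub>M \<nu>) f"
    using fb a by (intro P.integrable_bounded[where B=B]) (auto simp: sp abs_le_iff, fastforce+)
  have b2: "\<bar>f (x, y) * ln (g x)\<bar> \<le> B * (\<bar>ln a\<bar> + \<bar>ln B\<bar>)" if "x \<in> space \<mu>" "y \<in> space \<nu>" for x y
    unfolding abs_mult using fb[OF that] lng[OF that(1)] a B by (intro mult_mono) auto
  have if2: "integrable (\<mu> \<Otimes>\<^sub>M \<nu>) (\<lambda>(x, y). f (x, y) * ln (g x))"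
    using b2 by (intro P.integrable_bounded) (auto simp: sp)
  have e1: "(\<integral>y. (\<integral>x. f (x, y) \<partial>\<mu>) \<partial>\<nu>) = (\<integral>x. g x \<partial>\<mu>)"
    using P.Fubini_integral[of "\<lambda>x y. f (x, y)"] if1 by (simp add: g_def)
  have e2: "(\<integral>y. (\<integral>x. f (x, y) * ln (g x) \<partial>\<mu>) \<partial>\<nu>) = (\<integral>x. g x * ln (g x) \<partial>\<mu>)"
    using P.Fubini_integral[of "\<lambda>x y. f (x, y) * ln (g x)"] if2 by (simp add: g_def)
  have i1: "integrable \<nu> (\<lambda>y. \<integral>x. f (x, y) \<partial>\<mu>)"
    using P.integrable_snd[of "\<lambda>x y. f (x, y)"] if1 by simp
  have i2: "integrable \<nu> (\<lambda>y. \<integral>x. f (x, y) * ln (g x) \<partial>\<mu>)"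
    using P.integrable_snd[of "\<lambda>x y. f (x, y) * ln (g x)"] if2 by simp
  have m: "(\<lambda>x. f (x, y)) \<in> borel_measurable \<mu>" if "y \<in> space \<nu>" for y
    using that by measurable
  have "(\<lambda>y. Ent \<mu> (\<lambda>x. f (x, y))) \<in> borel_measurable \<nu>"
    unfolding Ent_def by measurable
  moreover have "\<bar>Ent \<mu> (\<lambda>x. f (x, y))\<bar> \<le> 2 * (B * (\<bar>ln a\<bar> + \<bar>ln B\<bar>))" if "y \<in> space \<nu>" for y
    using fb that by (intro \<mu>.abs_Ent_le[OF m a]) auto
  ultimately have i3: "integrable \<nu> (\<lambda>y. Ent \<mu> (\<lambda>x. f (x, y)))"
    by (intro \<nu>.integrable_bounded)
  have "(\<integral>y. (\<integral>x. f (x, y) * ln (g x) \<partial>\<mu>) - (\<integral>x. f (x, y) \<partial>\<mu>) * ln (\<integral>x. g x \<partial>\<mu>) \<partial>\<nu>)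
      \<le> (\<integral>y. Ent \<mu> (\<lambda>x. f (x, y)) \<partial>\<nu>)"
    using i1 i2 i3 fb gb by (intro integral_mono \<mu>.Ent_variational[OF m g a, where B=B]) auto
  then show ?thesis
    using i1 i2 by (simp add: e1 e2 Ent_def[of \<mu> g] g_def[symmetric])
qed

section \<open>Resampling a coordinate and subadditivity of entropy\<close>

context product_prob_space
begin

text \<open>Redrawing coordinate \<open>k\<close> from its own law preserves the product law: the
  inner integral ignores the old value at \<open>k\<close>, so integrating that value out
  contributes only the total mass 1.\<close>

lemma integral_resample:
  fixes G :: "('i \<Rightarrow> 'a) \<Rightarrow> real"
  assumes J: "finite J" "k \<in> J" and G[measurable]: "G \<in> borel_measurable (PiM J M)"
    and b: "\<And>w. w \<in> space (PiM J M) \<Longrightarrow> \<bar>G w\<bar> \<le> B"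
  shows "(\<integral>w. (\<integral>x. G (w(k := x)) \<partial>M k) \<partial>PiM J M) = (\<integral>w. G w \<partial>PiM J M)"
    and "integrable (PiM J M) (\<lambda>w. \<integral>x. G (w(k := x)) \<partial>M k)"
proof -
  interpret J: prob_space "PiM J M" by (rule prob_space_PiM) (rule prob_space)
  define I where "I = J - {k}"
  have I: "finite I" "k \<notin> I" "J = insert k I" using J by (auto simp: I_def)
  have upd: "w(k := x) \<in> space (PiM J M)" if "w \<in> space (PiM J M)" "x \<in> space (M k)" for w x
    using that J by (auto simp: space_PiM PiE_iff extensional_def)
  have [measurable]: "(\<lambda>(w, x). w(k := x)) \<in> PiM J M \<Otimes>\<^sub>M M k \<rightarrow>\<^sub>M PiM J M"
    using measurable_fun_upd[of J J k fst "PiM J M \<Otimes>\<^sub>M M k" M snd] J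
    by (auto simp: case_prod_beta insert_absorb)
  have m: "(\<lambda>w. \<integral>x. G (w(k := x)) \<partial>M k) \<in> borel_measurable (PiM J M)"
    by measurable
  have "\<bar>\<integral>x. G (w(k := x)) \<partial>M k\<bar> \<le> B" if w: "w \<in> space (PiM J M)" for w
  proof -
    have "(\<lambda>x. G (w(k := x))) \<in> borel_measurable (M k)" using w by measurable
    then show ?thesis
      using b[OF upd[OF w]] M.integral_between[of "\<lambda>x. G (w(k := x))" k "-B" B]
      by (force simp: abs_le_iff)
  qed
  then show int: "integrable (PiM J M) (\<lambda>w. \<integral>x. G (w(k := x)) \<partial>M k)"
    using m by (rule J.integrable_bounded[rotated])
  have iG: "integrable (PiM J M) G" using b by (intro J.integrable_bounded) auto
  show "(\<integral>w. (\<integral>x. G (w(k := x)) \<partial>M k) \<partial>PiM J M) = (\<integral>w. G w \<partial>PiM J M)"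
    using product_integral_insert[OF I(1,2) int[unfolded I(3)]]
      product_integral_insert[OF I(1,2) iG[unfolded I(3)]]
    by (simp add: I(3)[symmetric] M.prob_space)
qed

text \<open>Induction on the index set. The chain rule splits off coordinate \<open>i\<close> and
  leaves the entropy of the average \<open>g\<close> over it. The induction hypothesis applies to
  \<open>g\<close>, and convexity of entropy moves that average outside the one-coordinate
  entropies.\<close>

theorem Ent_tensorization:
  assumes "finite I" and f: "f \<in> borel_measurable (PiM I M)" and a: "0 < a"
    and fb: "\<And>w. w \<in> space (PiM I M) \<Longrightarrow> a \<le> f w" "\<And>w. w \<in> space (PiM I M) \<Longrightarrow> f w \<le> B"
  shows "Ent (PiM I M) f \<le> (\<Sum>k\<in>I. \<integral>w. Ent (M k) (\<lambda>x. f (w(k := x))) \<partial>PiM I M)"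
  using assms
proof (induction I arbitrary: f rule: finite_induct)
  case empty
  \<comment> \<open>\<open>PiM {} M\<close> is a point mass, where the two terms of the entropy
    cancel.\<close>
  show ?case
    by (simp add: Ent_def PiM_empty lebesgue_integral_count_space_finite)
next
  case (insert i I)
  note f[measurable] = insert.prems(1)
  note fb = insert.prems(3,4)
  let ?J = "insert i I"
  interpret I: prob_space "PiM I M" by (rule prob_space_PiM) (rule prob_space)
  interpret J: prob_space "PiM ?J M" by (rule prob_space_PiM) (rule prob_space)
  have upd: "w(i := y) \<in> space (PiM ?J M)" if "w \<in> space (PiM I M)" "y \<in> space (M i)" for w y
    using that by (auto simp: space_PiM PiE_iff extensional_def)
  have updJ: "w(k := y) \<in> space (PiM ?J M)" if "w \<in> space (PiM ?J M)" "k \<in> ?J" "y \<in> space (M k)" for w y k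
    using that by (auto simp: space_PiM PiE_iff extensional_def)
  have updI: "w(k := y) \<in> space (PiM I M)" if "w \<in> space (PiM I M)" "k \<in> I" "y \<in> space (M k)" for w y k
    using that by (auto simp: space_PiM PiE_iff extensional_def)
  define g where "g w = (\<integral>y. f (w(i := y)) \<partial>M i)" for w
  have g[measurable]: "g \<in> borel_measurable (PiM I M)" unfolding g_def by measurable
  have gb: "a \<le> g w" "g w \<le> B" if "w \<in> space (PiM I M)" for w
  proof -
    have "(\<lambda>y. f (w(i := y))) \<in> borel_measurable (M i)" using that by measurable
    then show "a \<le> g w" "g w \<le> B"
      unfolding g_def using M.integral_between[of "\<lambda>y. f (w(i := y))" i a B] fb upd[OF that] by auto
  qed
  let ?C = "2 * (B * (\<bar>ln a\<bar> + \<bar>ln B\<bar>))"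
  have mJ: "(\<lambda>(w, x). w(k := x)) \<in> PiM ?J M \<Otimes>\<^sub>M M k \<rightarrow>\<^sub>M PiM ?J M" if "k \<in> ?J" for k
    using measurable_fun_upd[of ?J ?J k fst "PiM ?J M \<Otimes>\<^sub>M M k" M snd] that
    by (auto simp: case_prod_beta insert_absorb)
  have mI: "(\<lambda>(w, x). w(k := x)) \<in> PiM I M \<Otimes>\<^sub>M M k \<rightarrow>\<^sub>M PiM I M" if "k \<in> I" for k
    using measurable_fun_upd[of I I k fst "PiM I M \<Otimes>\<^sub>M M k" M snd] that
    by (auto simp: case_prod_beta insert_absorb)
  have intE: "integrable (PiM ?J M) (\<lambda>w. Ent (M k) (\<lambda>x. f (w(k := x))))" if k: "k \<in> ?J" for k
  proof (rule J.integrable_bounded)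
    note [measurable] = mJ[OF k]
    show "(\<lambda>w. Ent (M k) (\<lambda>x. f (w(k := x)))) \<in> borel_measurable (PiM ?J M)"
      unfolding Ent_def by measurable
    show "\<bar>Ent (M k) (\<lambda>x. f (w(k := x)))\<bar> \<le> ?C" if w: "w \<in> space (PiM ?J M)" for w
    proof (rule M.abs_Ent_le)
      show "(\<lambda>x. f (w(k := x))) \<in> borel_measurable (M k)" using w by measurable
    qed (use fb updJ[OF w k] a in auto)
  qed
  have intEI: "integrable (PiM I M) (\<lambda>w. Ent (M k) (\<lambda>x. g (w(k := x))))" if k: "k \<in> I" for k
  proof (rule I.integrable_bounded)
    note [measurable] = mI[OF k]
    show "(\<lambda>w. Ent (M k) (\<lambda>x. g (w(k := x)))) \<in> borel_measurable (PiM I M)"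
      unfolding Ent_def by measurable
    show "\<bar>Ent (M k) (\<lambda>x. g (w(k := x)))\<bar> \<le> ?C" if w: "w \<in> space (PiM I M)" for w
    proof (rule M.abs_Ent_le)
      show "(\<lambda>x. g (w(k := x))) \<in> borel_measurable (M k)" using w by measurable
    qed (use gb updI[OF w k] a in auto)
  qed
  have iterate: "(\<integral>w. Ent (M k) (\<lambda>x. f (w(k := x))) \<partial>PiM ?J M)
      = (\<integral>w. (\<integral>y. Ent (M k) (\<lambda>x. f (w(i := y, k := x))) \<partial>M i) \<partial>PiM I M)" if "k \<in> ?J" for k
    by (rule product_integral_insert[OF insert.hyps intE[OF that]])
  \<comment> \<open>Chain rule: \<open>g w * ln (g w)\<close> is subtracted in each fibre and
    returns as the first term of \<open>Ent (PiM I M) g\<close>.\<close>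
  have split: "Ent (PiM ?J M) f = (\<integral>w. Ent (M i) (\<lambda>x. f (w(i := x))) \<partial>PiM I M) + Ent (PiM I M) g"
  proof -
    have i1: "integrable (PiM ?J M) f"
      using fb a by (intro J.integrable_bounded[where B=B]) (auto simp: abs_le_iff, fastforce)
    have i2: "integrable (PiM ?J M) (\<lambda>w. f w * ln (f w))"
      using abs_mult_ln_le[OF a fb] by (intro J.integrable_bounded) auto
    have e1: "(\<integral>w. f w \<partial>PiM ?J M) = (\<integral>w. g w \<partial>PiM I M)"
      unfolding g_def by (rule product_integral_insert[OF insert.hyps i1])
    have e2: "(\<integral>w. f w * ln (f w) \<partial>PiM ?J M)
       = (\<integral>w. (\<integral>y. f (w(i := y)) * ln (f (w(i := y))) \<partial>M i) \<partial>PiM I M)"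
      by (rule product_integral_insert[OF insert.hyps i2])
    have i3: "integrable (PiM I M) (\<lambda>w. g w * ln (g w))"
      using abs_mult_ln_le[OF a gb] by (intro I.integrable_bounded) auto
    have i4: "integrable (PiM I M) (\<lambda>w. Ent (M i) (\<lambda>x. f (w(i := x))))"
    proof (rule I.integrable_bounded)
      show "(\<lambda>w. Ent (M i) (\<lambda>x. f (w(i := x)))) \<in> borel_measurable (PiM I M)"
        unfolding Ent_def by measurable
      show "\<bar>Ent (M i) (\<lambda>x. f (w(i := x)))\<bar> \<le> ?C" if w: "w \<in> space (PiM I M)" for w
      proof (rule M.abs_Ent_le)
        show "(\<lambda>x. f (w(i := x))) \<in> borel_measurable (M i)" using w by measurable
      qed (use fb upd[OF w] a in auto)
    qed
    have "(\<integral>w. (\<integral>y. f (w(i := y)) * ln (f (w(i := y))) \<partial>M i) \<partial>PiM I M)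
        = (\<integral>w. Ent (M i) (\<lambda>x. f (w(i := x))) + g w * ln (g w) \<partial>PiM I M)"
      by (simp add: Ent_def g_def)
    also have "\<dots> = (\<integral>w. Ent (M i) (\<lambda>x. f (w(i := x))) \<partial>PiM I M) + (\<integral>w. g w * ln (g w) \<partial>PiM I M)"
      using i3 i4 by simp
    finally show ?thesis
      unfolding Ent_def[of "PiM ?J M"] Ent_def[of "PiM I M" g] e1 e2 by simp
  qed
  have head: "(\<integral>w. Ent (M i) (\<lambda>x. f (w(i := x))) \<partial>PiM I M)
      = (\<integral>w. Ent (M i) (\<lambda>x. f (w(i := x))) \<partial>PiM ?J M)"
    by (simp add: iterate M.prob_space)
  have "Ent (PiM I M) g \<le> (\<Sum>k\<in>I. \<integral>w. Ent (M k) (\<lambda>x. g (w(k := x))) \<partial>PiM I M)"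
    using insert.IH[OF g a gb] .
  also have "\<dots> \<le> (\<Sum>k\<in>I. \<integral>w. Ent (M k) (\<lambda>x. f (w(k := x))) \<partial>PiM ?J M)"
  proof (rule sum_mono)
    fix k assume k: "k \<in> I"
    then have ki: "k \<noteq> i" and kJ: "k \<in> ?J" using insert.hyps by auto
    have swap: "w(i := y, k := x) = w(k := x, i := y)" for w :: "'i \<Rightarrow> 'a" and x y
      using ki by (rule fun_upd_twist[symmetric])
    have "integrable (PiM I M) (\<lambda>w. \<integral>y. Ent (M k) (\<lambda>x. f (w(i := y, k := x))) \<partial>M i)"
    proof (rule I.integrable_bounded)
      note [measurable] = mJ[OF kJ]
      have mE: "(\<lambda>w. Ent (M k) (\<lambda>x. f (w(k := x)))) \<in> borel_measurable (PiM ?J M)"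
        using intE[OF kJ] by simp
      show "(\<lambda>w. \<integral>y. Ent (M k) (\<lambda>x. f (w(i := y, k := x))) \<partial>M i) \<in> borel_measurable (PiM I M)"
        using measurable_compose[OF measurable_add_dim mE]
        by (intro M.borel_measurable_lebesgue_integral) (simp add: case_prod_beta)
      fix w assume w: "w \<in> space (PiM I M)"
      have m: "(\<lambda>y. Ent (M k) (\<lambda>x. f (w(i := y, k := x)))) \<in> borel_measurable (M i)"
        using measurable_compose[OF measurable_component_update[OF w insert.hyps(2)] mE] by simp
      have "\<bar>Ent (M k) (\<lambda>x. f (w(i := y, k := x)))\<bar> \<le> ?C" if y: "y \<in> space (M i)" for y
      proof (rule M.abs_Ent_le)
        have "w(i := y) \<in> space (PiM ?J M)" using upd w y .
        then show "(\<lambda>x. f (w(i := y, k := x))) \<in> borel_measurable (M k)"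
          by measurable
      qed (use fb updJ[OF upd[OF w y] kJ] a in auto)
      then show "\<bar>\<integral>y. Ent (M k) (\<lambda>x. f (w(i := y, k := x))) \<partial>M i\<bar> \<le> ?C"
        using M.integral_between[OF m, of "- ?C" ?C] by (force simp: abs_le_iff)
    qed
    moreover have "Ent (M k) (\<lambda>x. g (w(k := x))) \<le> (\<integral>y. Ent (M k) (\<lambda>x. f (w(i := y, k := x))) \<partial>M i)"
      if w: "w \<in> space (PiM I M)" for w
    proof -
      \<comment> \<open>Convexity is applied to \<open>f\<close> as a jointly measurable function of
        the coordinates \<open>k\<close> and \<open>i\<close> alone, the others being frozen at
        \<open>w\<close>.\<close>
      have "(\<lambda>(x, y). w(k := x, i := y)) \<in> M k \<Otimes>\<^sub>M M i \<rightarrow>\<^sub>M PiM ?J M"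
        unfolding case_prod_beta
        using measurable_fun_upd[of I I k "\<lambda>_. w" "M k \<Otimes>\<^sub>M M i" M fst] w k
        by (intro measurable_fun_upd[of _ I]) (auto simp: insert_absorb)
      from measurable_compose[OF this f]
      have mF: "(\<lambda>p. f (w(k := fst p, i := snd p))) \<in> borel_measurable (M k \<Otimes>\<^sub>M M i)"
        by (simp only: case_prod_beta)
      have "Ent (M k) (\<lambda>x. \<integral>y. f (w(k := fst (x, y), i := snd (x, y))) \<partial>M i)
         \<le> (\<integral>y. Ent (M k) (\<lambda>x. f (w(k := fst (x, y), i := snd (x, y)))) \<partial>M i)"
        by (rule Ent_convex[OF prob_space prob_space mF a, where B=B])
          (simp_all only: fst_conv snd_conv fb upd updI w k)
      then show ?thesis by (simp add: g_def swap)
    qed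
    ultimately show "(\<integral>w. Ent (M k) (\<lambda>x. g (w(k := x))) \<partial>PiM I M)
        \<le> (\<integral>w. Ent (M k) (\<lambda>x. f (w(k := x))) \<partial>PiM ?J M)"
      unfolding iterate[OF kJ] using intEI[OF k] by (intro integral_mono) auto
  qed
  finally show ?case
    unfolding sum.insert[OF insert.hyps] split head by (rule add_left_mono)
qed

end

section \<open>Entropy of exponentials of maxima\<close>

text \<open>Squaring the quadratic bound for \<open>exp (y/2)\<close> gives the coefficient 3/4 +
  y/4 + y^2/16, at most 0.8025 on [0, 1/5]. For negative \<open>y\<close> the coefficient 1/2 works
  without a lower limit, so that applications only have to bound the exponent from above.\<close>

lemma exp_le_quadratic:
  fixes y :: real
  assumes "y \<le> 1/5"
  shows "exp y \<le> 1 + y + (81/100) * y\<^sup>2"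
proof (cases "0 \<le> y")
  case True
  have "exp y = (exp (y/2))\<^sup>2" by (simp add: exp_double[symmetric])
  also have "\<dots> \<le> (1 + y/2 + (y/2)\<^sup>2)\<^sup>2"
    using True assms by (intro power_mono exp_bound) auto
  also have "\<dots> = 1 + y + y\<^sup>2 * (3/4 + y/4 + y\<^sup>2/16)" by (simp add: power2_eq_square algebra_simps)
  also have "\<dots> \<le> 1 + y + y\<^sup>2 * (81/100)"
  proof -
    have "y\<^sup>2 \<le> (1/5)\<^sup>2" using True assms by (intro power_mono) auto
    then have "3/4 + y/4 + y\<^sup>2/16 \<le> 81/100" using assms by (simp add: power2_eq_square)
    then show ?thesis by (intro add_left_mono mult_left_mono) auto
  qed
  finally show ?thesis by simp
next
  case False
  let ?g = "\<lambda>y::real. 1 + y + y\<^sup>2/2 - exp y"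
  have "?g 0 \<le> ?g y"
  proof (rule DERIV_nonpos_imp_nonincreasing[where f="?g"])
    show "y \<le> 0" using False by simp
    fix x :: real
    have "(?g has_real_derivative (1 + x - exp x)) (at x)"
      by (auto intro!: derivative_eq_intros)
    moreover have "1 + x - exp x \<le> 0" using exp_ge_add_one_self[of x] by simp
    ultimately show "\<exists>d. (?g has_real_derivative d) (at x) \<and> d \<le> 0" by blast
  qed
  then have "exp y \<le> 1 + y + (1/2) * y\<^sup>2" by simp
  also have "\<dots> \<le> 1 + y + (81/100) * y\<^sup>2"
    by (intro add_left_mono mult_right_mono) auto
  finally show ?thesis .
qed

text \<open>The tangent to \<open>x * ln x\<close> at \<open>c = exp (t * \<alpha>)\<close> bounds
  the subtracted term of the entropy from below. What remains is the integral of
  \<open>exp (t * h x) * (exp y - 1 - y)\<close> with \<open>y = - t * (h x - \<alpha>)\<close>. The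
  centre \<open>\<alpha>\<close> is free; it need not be the mean of \<open>h\<close>.\<close>

lemma (in prob_space) Ent_exp_le:
  fixes h :: "'a \<Rightarrow> real"
  assumes h[measurable]: "h \<in> borel_measurable M" and hb: "\<And>x. x \<in> space M \<Longrightarrow> \<bar>h x\<bar> \<le> B"
    and small: "\<And>x. x \<in> space M \<Longrightarrow> - t * (h x - \<alpha>) \<le> 1/5"
  shows "Ent M (\<lambda>x. exp (t * h x)) \<le> (81/100) * t\<^sup>2 * (\<integral>x. exp (t * h x) * (h x - \<alpha>)\<^sup>2 \<partial>M)"
proof -
  have tb: "\<bar>t * h x\<bar> \<le> \<bar>t\<bar> * B" if "x \<in> space M" for x
    using hb[OF that] by (simp add: abs_mult mult_left_mono)
  have eb: "exp (t * h x) \<le> exp (\<bar>t\<bar> * B)" if "x \<in> space M" for x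
    using tb[OF that] by auto
  define F where "F = (\<integral>x. exp (t * h x) \<partial>M)"
  define c where "c = exp (t * \<alpha>)"
  have i1: "integrable M (\<lambda>x. exp (t * h x))"
    using eb by (intro integrable_bounded[where B="exp (\<bar>t\<bar> * B)"]) auto
  have i2: "integrable M (\<lambda>x. exp (t * h x) * (t * h x))"
    by (intro integrable_bounded[where B="exp (\<bar>t\<bar> * B) * (\<bar>t\<bar> * B)"])
      (auto simp: abs_mult[of "exp _"] intro!: mult_mono eb tb)
  have i3: "integrable M (\<lambda>x. exp (t * h x) * (h x - \<alpha>)\<^sup>2)"
  proof (intro integrable_bounded[where B="exp (\<bar>t\<bar> * B) * (B + \<bar>\<alpha>\<bar>)\<^sup>2"])
    fix x assume x: "x \<in> space M"
    have "(h x - \<alpha>)\<^sup>2 \<le> (B + \<bar>\<alpha>\<bar>)\<^sup>2"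
      using hb[OF x] by (intro power2_le_iff_abs_le[THEN iffD2]) auto
    then show "\<bar>exp (t * h x) * (h x - \<alpha>)\<^sup>2\<bar> \<le> exp (\<bar>t\<bar> * B) * (B + \<bar>\<alpha>\<bar>)\<^sup>2"
      using eb[OF x] by (auto simp: abs_mult intro!: mult_mono)
  qed measurable
  have F: "0 < F"
  proof -
    have "exp (- (\<bar>t\<bar> * B)) \<le> F" unfolding F_def
      using tb by (intro integral_ge_const i1 AE_I2) (force simp: abs_le_iff)
    then show ?thesis by (rule less_le_trans[rotated]) simp
  qed
  have "F * ln c + F - c \<le> F * ln F"
  proof -
    have "ln (c / F) \<le> c / F - 1" using F by (intro ln_le_minus_one) (auto simp: c_def)
    then have "F * ln (c / F) \<le> F * (c / F - 1)" using F by (intro mult_left_mono) auto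
    then show ?thesis using F by (simp add: ln_div c_def algebra_simps)
  qed
  then have "Ent M (\<lambda>x. exp (t * h x)) \<le> (\<integral>x. exp (t * h x) * (t * h x) \<partial>M) - (F * (t * \<alpha>) + F - c)"
    by (simp add: Ent_def F_def c_def)
  also have "\<dots> = (\<integral>x. exp (t * h x) * (t * h x) - exp (t * h x) * (t * \<alpha>) - exp (t * h x) + c \<partial>M)"
    using i1 i2 by (simp add: F_def prob_space)
  also have "\<dots> \<le> (\<integral>x. (81/100) * t\<^sup>2 * (exp (t * h x) * (h x - \<alpha>)\<^sup>2) \<partial>M)"
  proof (rule integral_mono)
    fix x assume x: "x \<in> space M"
    let ?y = "- t * (h x - \<alpha>)"
    have "c = exp (t * h x) * exp ?y" by (simp add: c_def exp_add[symmetric] algebra_simps)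
    then have "exp (t * h x) * (t * h x) - exp (t * h x) * (t * \<alpha>) - exp (t * h x) + c
      = exp (t * h x) * (exp ?y - 1 - ?y)" by (simp add: algebra_simps)
    also have "\<dots> \<le> exp (t * h x) * ((81/100) * ?y\<^sup>2)"
      using exp_le_quadratic[OF small[OF x]] by (intro mult_left_mono) auto
    also have "\<dots> = (81/100) * t\<^sup>2 * (exp (t * h x) * (h x - \<alpha>)\<^sup>2)"
      by (simp add: power_mult_distrib)
    finally show "exp (t * h x) * (t * h x) - exp (t * h x) * (t * \<alpha>) - exp (t * h x) + c
       \<le> (81/100) * t\<^sup>2 * (exp (t * h x) * (h x - \<alpha>)\<^sup>2)" .
  qed (use i1 i2 i3 in auto)
  finally show ?thesis by simp
qed

text \<open>
  Since \<open>s = \<tau> y\<close> is a maximiser at a second point \<open>y\<close>, the entropy can be compared with the constant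
  \<open>c s + expectation (g s)\<close>, on which the maximiser at the integration variable has no influence.
  The excess \<open>h x - c s - g s x\<close> is nonnegative and at most \<open>4 * b\<close>, so its square is controlled by its
  mean, and that mean telescopes once \<open>y\<close> is integrated out. This replaces symmetrisation and contraction.
\<close>
lemma (in prob_space) Ent_exp_max_le:
  fixes h :: "'a \<Rightarrow> real" and g :: "nat \<Rightarrow> 'a \<Rightarrow> real" and c :: "nat \<Rightarrow> real"
    and \<tau> :: "'a \<Rightarrow> nat"
  assumes h[measurable]: "h \<in> borel_measurable M"
    and \<tau>: "\<tau> \<in> M \<rightarrow>\<^sub>M count_space S"
    and g[measurable]: "\<And>s. s \<in> S \<Longrightarrow> g s \<in> borel_measurable M"
    and gb: "\<And>s x. s \<in> S \<Longrightarrow> x \<in> space M \<Longrightarrow> \<bar>g s x\<bar> \<le> b"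
    and h_ge: "\<And>s x. s \<in> S \<Longrightarrow> x \<in> space M \<Longrightarrow> c s + g s x \<le> h x"
    and h_eq: "\<And>x. x \<in> space M \<Longrightarrow> h x = c (\<tau> x) + g (\<tau> x) x"
    and t: "0 \<le> t \<and> t * b \<le> 1/10 \<or> t \<le> 0 \<and> - t * b \<le> 1/172"
  shows "Ent M (\<lambda>x. exp (t * h x)) \<le> (9/8) * t\<^sup>2 *
    (\<integral>x. exp (t * h x) * (8 * b * (g (\<tau> x) x - expectation (g (\<tau> x)))
              + expectation (\<lambda>y. (g (\<tau> x) y)\<^sup>2)) \<partial>M)"
proof -
  define m where "m s = expectation (g s)" for s
  define q where "q s = expectation (\<lambda>y. (g s y)\<^sup>2)" for s
  define H where "H = expectation h"
  \<comment> \<open>\<open>E\<close> bounds the ratio of \<open>f\<close> at two points, since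
    \<open>h\<close> oscillates by at most \<open>2 * b\<close>.\<close>
  define E where "E = exp (2 * \<bar>t\<bar> * b)"
  define f where "f x = exp (t * h x)" for x
  have f[measurable]: "f \<in> borel_measurable M" unfolding f_def by measurable
  have \<tau>S: "\<tau> x \<in> S" if "x \<in> space M" for x
    using measurable_space[OF \<tau> that] by simp
  obtain x1 where x1: "x1 \<in> space M" using not_empty by auto
  have b0: "0 \<le> b" using gb[OF \<tau>S[OF x1] x1] by linarith
  have osc: "h x - h y \<le> 2 * b" if "x \<in> space M" "y \<in> space M" for x y
    using h_ge[OF \<tau>S[OF that(1)] that(2)] h_eq[OF that(1)]
      gb[OF \<tau>S[OF that(1)] that(1)] gb[OF \<tau>S[OF that(1)] that(2)] by linarith
  define B where "B = \<bar>h x1\<bar> + 2 * b"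
  have hB: "\<bar>h x\<bar> \<le> B" if "x \<in> space M" for x
    using osc[OF that x1] osc[OF x1 that] by (auto simp: B_def)
  have ih: "integrable M h" using hB by (intro integrable_bounded) auto
  have hH: "\<bar>h x - H\<bar> \<le> 2 * b" if "x \<in> space M" for x
  proof -
    have "h x - 2 * b \<le> H" "H \<le> h x + 2 * b" unfolding H_def
      using osc[OF that] osc[OF _ that]
      by (intro integral_ge_const integral_le_const ih AE_I2; fastforce simp: algebra_simps)+
    then show ?thesis by linarith
  qed
  have mb: "\<bar>m s\<bar> \<le> b" if "s \<in> S" for s
    using integral_between[OF g[OF that], of "- b" b] gb[OF that]
    by (force simp: m_def abs_le_iff)
  have sqb: "(g s x)\<^sup>2 \<le> b\<^sup>2" if "s \<in> S" "x \<in> space M" for s x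
    using gb[OF that] b0 by (intro power2_le_iff_abs_le[THEN iffD2]) auto
  have qb: "0 \<le> q s" "q s \<le> b\<^sup>2" if "s \<in> S" for s
    using integral_between[of "\<lambda>x. (g s x)\<^sup>2" 0 "b\<^sup>2"] sqb that g[OF that]
    by (auto simp: q_def)
  have E0: "0 < E" by (simp add: E_def)
  have f0: "0 < f x" for x by (simp add: f_def)
  have fE: "f x \<le> E * f y" if "x \<in> space M" "y \<in> space M" for x y
  proof -
    have "\<bar>h x - h y\<bar> \<le> 2 * b" using osc[of x y] osc[of y x] that by auto
    then have "\<bar>t\<bar> * \<bar>h x - h y\<bar> \<le> \<bar>t\<bar> * (2 * b)" by (intro mult_left_mono) auto
    then have "t * (h x - h y) \<le> 2 * \<bar>t\<bar> * b"
      by (metis abs_mult abs_le_D1 mult.left_commute mult.assoc)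
    then have "t * h x \<le> 2 * \<bar>t\<bar> * b + t * h y" by (simp add: algebra_simps)
    then show ?thesis by (simp add: E_def f_def exp_add[symmetric])
  qed
  \<comment> \<open>This is \<open>8 * b * (H - c s - m s) + q s\<close> at
    \<open>s = \<tau> x\<close>, rewritten by \<open>c s = h x - g s x\<close>. In this form
    \<open>c\<close> has disappeared, and the first summand is proportional to a deviation of
    \<open>h\<close> from its mean.\<close>
  define V where "V x = 8 * b * (H - h x) + (8 * b * (g (\<tau> x) x - m (\<tau> x)) + q (\<tau> x))" for x
  have step: "Ent M f \<le> (81/100) * t\<^sup>2 * E * (f y * V y)"
       "(\<integral>x. f x * (h x - H)\<^sup>2 \<partial>M) \<le> E * (f y * V y)" if y: "y \<in> space M" for y
  proof -
    define s where "s = \<tau> y"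
    have s: "s \<in> S" using \<tau>S[OF y] by (simp add: s_def)
    note [measurable] = g[OF s]
    define \<alpha> where "\<alpha> = c s + m s"
    have AX: "0 \<le> h x - c s - g s x" "h x - c s - g s x \<le> 4 * b"
         "\<bar>g s x - m s\<bar> \<le> 2 * b" if x: "x \<in> space M" for x
      using h_ge[OF s x] osc[OF x y] h_eq[OF y] gb[OF s x] gb[OF s y] mb[OF s]
      by (auto simp: s_def[symmetric])
    have D: "(h x - \<alpha>)\<^sup>2 \<le> 8 * b * (h x - c s - g s x) + (g s x - m s)\<^sup>2"
      if x: "x \<in> space M" for x
    proof -
      define A where "A = h x - c s - g s x"
      define X where "X = g s x - m s"
      \<comment> \<open>Origin of the factor 8: \<open>A\<close> lies between 0 and
        \<open>4 * b\<close> and \<open>X\<close> is at most \<open>2 * b\<close>, while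
        \<open>(A + X)\<close> squared is \<open>A * (A + 2 * X)\<close> plus \<open>X\<close>
        squared. The square of the excess is thus paid for by its first power.\<close>
      have "A * (A + 2 * X) \<le> A * (8 * b)"
        using AX[OF x] by (intro mult_left_mono) (auto simp: A_def X_def)
      then have "(A + X)\<^sup>2 \<le> 8 * b * A + X\<^sup>2" by (simp add: power2_eq_square algebra_simps)
      moreover have "h x - \<alpha> = A + X" by (simp add: A_def X_def \<alpha>_def)
      ultimately show ?thesis by (simp only: A_def X_def)
    qed
    \<comment> \<open>For \<open>t \<ge> 0\<close> only \<open>h x - \<alpha> \<ge> - 2 * b\<close>
      matters, and 2/10 is the limit 1/5. For \<open>t \<le> 0\<close> the upper bound
      \<open>6 * b\<close> matters, and 6/172 is well below it.\<close>
    have small: "- t * (h x - \<alpha>) \<le> 1/5" if x: "x \<in> space M" for x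
    proof (cases "0 \<le> t \<and> t * b \<le> 1/10")
      case True
      have "- (2 * b) \<le> h x - \<alpha>" using AX[OF x] by (simp add: \<alpha>_def abs_le_iff)
      then have "t * - (2 * b) \<le> t * (h x - \<alpha>)" using True by (intro mult_left_mono) auto
      then show ?thesis using True by simp
    next
      case False
      then have t: "t \<le> 0" "- t * b \<le> 1/172" using t by auto
      have "h x - \<alpha> \<le> 6 * b" using AX[OF x] by (simp add: \<alpha>_def abs_le_iff)
      then have "- t * (h x - \<alpha>) \<le> - t * (6 * b)" using t by (intro mult_left_mono) auto
      then show ?thesis using t by simp
    qed
    have ig: "integrable M (g s)" using gb[OF s] by (intro integrable_bounded) auto
    have ig2: "integrable M (\<lambda>x. (g s x)\<^sup>2)" using sqb[OF s] by (intro integrable_bounded) auto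
    have ih2: "integrable M (\<lambda>x. (h x)\<^sup>2)"
      using hB by (intro integrable_bounded[where B="B\<^sup>2"]) (auto intro!: power2_le_iff_abs_le[THEN iffD2] order_trans[OF abs_ge_zero hB[OF x1]])
    have iD: "integrable M (\<lambda>x. (h x - \<alpha>)\<^sup>2)" for \<alpha>
      using ih ih2 by (simp add: power2_diff)
    have "expectation (\<lambda>x. (h x - \<alpha>)\<^sup>2) \<le> (\<integral>x. 8 * b * (h x - c s - g s x) + (g s x - m s)\<^sup>2 \<partial>M)"
      using iD ih ig ig2 by (intro integral_mono D) (auto simp: power2_diff)
    also have "\<dots> = 8 * b * (H - c s - m s) + (q s - (m s)\<^sup>2)"
      using ih ig ig2
      by (simp add: power2_diff H_def q_def m_def[symmetric] prob_space) (simp add: power2_eq_square)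
    also have "\<dots> \<le> V y"
      using h_eq[OF y] by (simp add: V_def s_def[symmetric] algebra_simps)
    finally have DV: "expectation (\<lambda>x. (h x - \<alpha>)\<^sup>2) \<le> V y" .
    have ifD: "integrable M (\<lambda>x. f x * (h x - \<alpha>)\<^sup>2)" for \<alpha>
      by (rule Bochner_Integration.integrable_bound[OF integrable_mult_right[OF iD, of "E * f y" \<alpha>]])
        (use fE[OF _ y] f0 E0 in \<open>auto intro!: mult_right_mono AE_I2 simp: abs_mult abs_of_pos\<close>)
    have fD: "(\<integral>x. f x * (h x - \<alpha>)\<^sup>2 \<partial>M) \<le> E * (f y * expectation (\<lambda>x. (h x - \<alpha>)\<^sup>2))" for \<alpha>
    proof -
      have "(\<integral>x. f x * (h x - \<alpha>)\<^sup>2 \<partial>M) \<le> (\<integral>x. (E * f y) * (h x - \<alpha>)\<^sup>2 \<partial>M)"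
        using ifD iD by (intro integral_mono mult_right_mono fE y) auto
      then show ?thesis by (simp add: mult.assoc)
    qed
    have "Ent M f \<le> (81/100) * t\<^sup>2 * (\<integral>x. f x * (h x - \<alpha>)\<^sup>2 \<partial>M)"
      unfolding f_def by (rule Ent_exp_le[OF h hB small])
    also have "\<dots> \<le> (81/100) * t\<^sup>2 * (E * (f y * V y))"
      by (intro mult_left_mono order_trans[OF fD] DV) (use f0[of y] E0 in auto)
    finally show "Ent M f \<le> (81/100) * t\<^sup>2 * E * (f y * V y)" by (simp add: mult.assoc)
    \<comment> \<open>The mean minimises the mean square deviation, so \<open>V y\<close> also
      controls the weighted second moment about \<open>H\<close>. This second estimate is what later
      bounds \<open>Q\<close> by a multiple of \<open>R\<close>.\<close>
    have "expectation (\<lambda>x. (h x - H)\<^sup>2) \<le> expectation (\<lambda>x. (h x - \<alpha>)\<^sup>2)"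
    proof -
      have "0 \<le> (H - \<alpha>)\<^sup>2" by simp
      then show ?thesis using ih ih2
        by (simp add: power2_diff prob_space H_def[symmetric] power2_eq_square algebra_simps)
    qed
    then have "expectation (\<lambda>x. (h x - H)\<^sup>2) \<le> V y" using DV by simp
    then show "(\<integral>x. f x * (h x - H)\<^sup>2 \<partial>M) \<le> E * (f y * V y)"
      by (intro order_trans[OF fD] mult_left_mono) (use f0[of y] E0 in auto)
  qed
  have S: "countable S" by simp
  have [measurable]: "(\<lambda>x. g (\<tau> x) x) \<in> borel_measurable M"
    by (rule measurable_compose_countable'[OF g \<tau> S])
  have [measurable]: "(\<lambda>x. m (\<tau> x)) \<in> borel_measurable M" "(\<lambda>x. q (\<tau> x)) \<in> borel_measurable M"
    by (rule measurable_compose[OF \<tau>], simp)+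
  define G where "G = (\<integral>x. f x * (8 * b * (g (\<tau> x) x - m (\<tau> x)) + q (\<tau> x)) \<partial>M)"
  define P where "P = (\<integral>x. f x * (H - h x) \<partial>M)"
  define Q where "Q = (\<integral>x. f x * (h x - H)\<^sup>2 \<partial>M)"
  have fb: "f x \<le> E * f x1" if "x \<in> space M" for x using fE[OF that x1] .
  have iG: "integrable M (\<lambda>x. f x * (8 * b * (g (\<tau> x) x - m (\<tau> x)) + q (\<tau> x)))"
  proof (rule integrable_bounded[where B="(E * f x1) * (8 * b * (2 * b) + b\<^sup>2)"])
    fix x assume x: "x \<in> space M"
    have "\<bar>8 * b * (g (\<tau> x) x - m (\<tau> x))\<bar> \<le> 8 * b * (2 * b)"
      using gb[OF \<tau>S[OF x] x] mb[OF \<tau>S[OF x]] b0 unfolding abs_mult by (intro mult_mono) auto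
    then have "\<bar>8 * b * (g (\<tau> x) x - m (\<tau> x)) + q (\<tau> x)\<bar> \<le> 8 * b * (2 * b) + b\<^sup>2"
      using qb[OF \<tau>S[OF x]] by linarith
    then show "\<bar>f x * (8 * b * (g (\<tau> x) x - m (\<tau> x)) + q (\<tau> x))\<bar> \<le> (E * f x1) * (8 * b * (2 * b) + b\<^sup>2)"
      unfolding abs_mult[of "f x"] using fb[OF x] f0[of x] f0[of x1] E0 by (intro mult_mono) auto
  qed measurable
  have iP: "integrable M (\<lambda>x. f x * (H - h x))"
  proof (rule integrable_bounded[where B="(E * f x1) * (2 * b)"])
    fix x assume x: "x \<in> space M"
    show "\<bar>f x * (H - h x)\<bar> \<le> (E * f x1) * (2 * b)"
      unfolding abs_mult using fb[OF x] f0[of x] f0[of x1] E0 hH[OF x] by (intro mult_mono) auto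
  qed measurable
  have iQ: "integrable M (\<lambda>x. f x * (h x - H)\<^sup>2)"
  proof (rule integrable_bounded[where B="(E * f x1) * (2 * b)\<^sup>2"])
    fix x assume x: "x \<in> space M"
    have "(h x - H)\<^sup>2 \<le> (2 * b)\<^sup>2"
      using hH[OF x] b0 by (intro power2_le_iff_abs_le[THEN iffD2]) auto
    then show "\<bar>f x * (h x - H)\<^sup>2\<bar> \<le> (E * f x1) * (2 * b)\<^sup>2"
      unfolding abs_mult using fb[OF x] f0[of x] f0[of x1] E0 by (intro mult_mono) auto
  qed measurable
  have fV: "f x * V x = 8 * b * (f x * (H - h x)) + f x * (8 * b * (g (\<tau> x) x - m (\<tau> x)) + q (\<tau> x))" for x
    by (simp add: V_def algebra_simps)
  have iV: "integrable M (\<lambda>x. f x * V x)" using iP iG by (simp add: fV)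
  define R where "R = (\<integral>x. f x * V x \<partial>M)"
  have R_eq: "R = 8 * b * P + G" using iP iG by (simp add: R_def P_def G_def fV)
  \<comment> \<open>The estimates in \<open>step\<close> hold for every \<open>y\<close> and their
    left sides do not depend on \<open>y\<close>, so \<open>f y * V y\<close> may be averaged over
    \<open>y\<close>.\<close>
  have Ent_R: "Ent M f \<le> (81/100) * t\<^sup>2 * E * R"
    using integral_ge_const[OF integrable_mult_right[OF iV, of "(81/100) * t\<^sup>2 * E"] AE_I2[OF step(1)]]
    by (simp add: R_def)
  have QR: "Q \<le> E * R"
    using integral_ge_const[OF integrable_mult_right[OF iV, of E] AE_I2[OF step(2)]]
    by (simp add: R_def Q_def)
  have "0 \<le> Q" unfolding Q_def using f0 by (intro integral_nonneg_AE AE_I2) (simp add: less_imp_le)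
  then have R0: "0 \<le> R" using QR E0 by (metis dual_order.trans zero_le_mult_iff less_le_not_le)
  have int0: "(\<integral>x. exp (t * H) * (H - h x) \<partial>M) = 0"
    using ih by (simp add: H_def prob_space)
  \<comment> \<open>For \<open>t \<ge> 0\<close> the term \<open>P\<close> has the right sign by monotonicity; for \<open>t < 0\<close> it is at most a small multiple of \<open>R\<close>
    and is absorbed.\<close>
  have "(81/100) * E * R \<le> (9/8) * G"
  proof (cases "0 \<le> t \<and> t * b \<le> 1/10")
    case True
    have "f x * (H - h x) \<le> exp (t * H) * (H - h x)" for x
    proof (cases "h x \<le> H")
      case True
      then show ?thesis using \<open>0 \<le> t \<and> _\<close> by (intro mult_right_mono) (auto simp: f_def mult_left_mono)
    next
      case False
      then show ?thesis using \<open>0 \<le> t \<and> _\<close> by (intro mult_right_mono_neg) (auto simp: f_def mult_left_mono)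
    qed
    then have "P \<le> (\<integral>x. exp (t * H) * (H - h x) \<partial>M)"
      unfolding P_def using iP ih by (intro integral_mono) auto
    then have "P \<le> 0" using int0 by simp
    then have RG: "R \<le> G" using R_eq b0 by (simp add: mult_nonneg_nonpos)
    have "E \<le> exp (1/5)" using True by (simp add: E_def)
    also have "\<dots> \<le> 1 + 1/5 + (1/5)\<^sup>2" by (rule exp_bound) auto
    finally have "E \<le> 5/4" by (simp add: power2_eq_square)
    then have "(81/100) * E * R \<le> (9/8) * R" using R0 by (intro mult_right_mono) auto
    then show ?thesis using RG by simp
  next
    case False
    then have t: "t \<le> 0" "- t * b \<le> 1/172" using t by auto
    \<comment> \<open>The weight \<open>f\<close> is replaced by the constant
      \<open>exp (t * H)\<close>, against which \<open>H - h\<close> integrates to zero; the error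
      is of first order in \<open>t\<close> and quadratic in \<open>h - H\<close>, hence bounded
      through \<open>Q\<close>.\<close>
    have "f x * (H - h x) \<le> exp (t * H) * (H - h x) + - t * E * (f x * (h x - H)\<^sup>2)"
      if x: "x \<in> space M" for x
    proof -
      define y where "y = - t * (H - h x)"
      have yb: "- y \<le> 2 * \<bar>t\<bar> * b"
      proof -
        have "- t * (h x - H) \<le> - t * (2 * b)" using hH[OF x] t by (intro mult_left_mono) auto
        then show ?thesis using t by (simp add: y_def algebra_simps)
      qed
      have "(1 - exp (- y)) * (H - h x) \<le> E * y * (H - h x)"
      proof (cases "h x \<le> H")
        case True
        then have "0 \<le> y" using t by (simp add: y_def mult_nonpos_nonneg)
        have "1 - exp (- y) \<le> y" using exp_ge_add_one_self[of "- y"] by simp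
        also have "\<dots> \<le> E * y" using \<open>0 \<le> y\<close> b0 by (simp add: mult_ge1_I E_def mult_le_cancel_right1)
        finally show ?thesis using True by (intro mult_right_mono) auto
      next
        case False
        then have y: "y \<le> 0" using t by (simp add: y_def mult_nonpos_nonpos)
        have "exp (- y) * (1 + y) \<le> exp (- y) * exp y" by (intro mult_left_mono exp_ge_add_one_self) auto
        then have "exp (- y) * y \<le> 1 - exp (- y)" by (simp add: algebra_simps exp_add[symmetric])
        moreover have "E * y \<le> exp (- y) * y" using yb y by (intro mult_right_mono_neg) (auto simp: E_def)
        ultimately have "E * y \<le> 1 - exp (- y)" by linarith
        then show ?thesis using False by (intro mult_right_mono_neg) auto
      qed
      then have "f x * ((1 - exp (- y)) * (H - h x)) \<le> f x * (E * y * (H - h x))"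
        using f0[of x] by (intro mult_left_mono) auto
      moreover have "f x * exp (- y) = exp (t * H)"
        by (simp add: f_def y_def exp_add[symmetric] algebra_simps)
      moreover have "f x * ((1 - exp (- y)) * (H - h x)) = f x * (H - h x) - (f x * exp (- y)) * (H - h x)"
        by (simp add: algebra_simps)
      moreover have "f x * (E * y * (H - h x)) = - t * E * (f x * (h x - H)\<^sup>2)"
        by (simp add: y_def power2_eq_square algebra_simps)
      ultimately show ?thesis by simp
    qed
    then have "P \<le> (\<integral>x. exp (t * H) * (H - h x) + - t * E * (f x * (h x - H)\<^sup>2) \<partial>M)"
      unfolding P_def using iP ih iQ by (intro integral_mono) auto
    also have "\<dots> = (\<integral>x. exp (t * H) * (H - h x) \<partial>M) + - t * E * Q"
      unfolding Q_def using ih iQ by (subst Bochner_Integration.integral_add) auto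
    finally have "P \<le> - t * E * Q" using int0 by simp
    also have "\<dots> \<le> - t * E * (E * R)" using t E0 QR by (intro mult_left_mono) (auto simp: mult_nonpos_nonneg)
    finally have "8 * b * P \<le> 8 * b * (- t * E * (E * R))" using b0 by (intro mult_left_mono) auto
    then have RR: "R \<le> 8 * (- t * b) * E\<^sup>2 * R + G" by (simp add: R_eq power2_eq_square algebra_simps)
    have "E \<le> exp (1/86)" using t by (simp add: E_def)
    also have "\<dots> \<le> 1 + 1/86 + (1/86)\<^sup>2" by (rule exp_bound) auto
    finally have E1: "E \<le> 102/100" by (simp add: power2_eq_square)
    then have "E\<^sup>2 \<le> (102/100)\<^sup>2" using E0 by (intro power_mono) auto
    \<comment> \<open>The number is about 0.05, so at least 9/10 of \<open>R\<close> survives the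
      absorption. With 0.81 * 1.02 in front of \<open>R\<close>, the final coefficient of
      \<open>G\<close> then stays below 9/8.\<close>
    then have "8 * (- t * b) * E\<^sup>2 \<le> 8 * (1/172) * (102/100)\<^sup>2"
      using t b0 by (intro mult_mono) (auto simp: mult_nonpos_nonneg)
    also have "\<dots> \<le> 1/10" by (simp add: power2_eq_square)
    finally have "8 * (- t * b) * E\<^sup>2 * R \<le> 1/10 * R" using R0 by (intro mult_right_mono)
    then have "(9/10) * R \<le> G" using RR by linarith
    moreover have "(81/100) * E * R \<le> (81/100) * (102/100) * R"
      using E1 R0 by (intro mult_right_mono) auto
    ultimately show ?thesis using R0 by simp
  qed
  then have "t\<^sup>2 * ((81/100) * E * R) \<le> t\<^sup>2 * ((9/8) * G)" by (intro mult_left_mono) auto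
  then have "Ent M f \<le> (9/8) * t\<^sup>2 * G" using Ent_R by (simp add: algebra_simps)
  then show ?thesis unfolding G_def f_def[abs_def] m_def q_def .
qed

text \<open>In coordinate \<open>k\<close> the maximum has the form treated above, with the other
  summands collected in the offset \<open>c s\<close>. After resampling, the bounds for all
  coordinates are integrals at the same point \<open>w\<close> with the same maximiser, so the
  single terms add up to \<open>Z w\<close>. The assumption on \<open>e\<close> takes the place of
  centring.\<close>

lemma (in product_prob_space) Ent_exp_Max_sum_le:
  fixes g :: "'i \<Rightarrow> nat \<Rightarrow> 'a \<Rightarrow> real" and S :: "nat set" and b t v e :: real
  defines "Z \<equiv> \<lambda>w. Max ((\<lambda>s. \<Sum>i\<in>I. g i s (w i)) ` S)"
  assumes I: "finite I" and S: "finite S" "S \<noteq> {}" and b0: "0 \<le> b"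
    and g: "\<And>i s. i \<in> I \<Longrightarrow> s \<in> S \<Longrightarrow> g i s \<in> borel_measurable (M i)"
    and gb: "\<And>i s x. i \<in> I \<Longrightarrow> s \<in> S \<Longrightarrow> x \<in> space (M i) \<Longrightarrow> \<bar>g i s x\<bar> \<le> b"
    and v: "\<And>s. s \<in> S \<Longrightarrow> (\<Sum>i\<in>I. \<integral>x. (g i s x)\<^sup>2 \<partial>M i) \<le> v"
    and e: "\<And>s. s \<in> S \<Longrightarrow> - (\<Sum>i\<in>I. \<integral>x. g i s x \<partial>M i) \<le> e"
    and t: "0 \<le> t \<and> t * b \<le> 1/10 \<or> t \<le> 0 \<and> - t * b \<le> 1/172"
  shows "Ent (PiM I M) (\<lambda>w. exp (t * Z w)) \<le> (9/8) * t\<^sup>2 *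
      (8 * b * ((\<integral>w. exp (t * Z w) * Z w \<partial>PiM I M) + e * (\<integral>w. exp (t * Z w) \<partial>PiM I M))
        + v * (\<integral>w. exp (t * Z w) \<partial>PiM I M))"
proof -
  define T where "T s w = (\<Sum>i\<in>I. g i s (w i))" for s and w :: "'i \<Rightarrow> 'a"
  have Z_T: "Z w = Max ((\<lambda>s. T s w) ` S)" for w by (simp add: Z_def T_def)
  define f where "f w = exp (t * Z w)" for w
  \<comment> \<open>Taking the least maximiser makes the selection measurable.\<close>
  define \<tau> where "\<tau> w = (LEAST s. s \<in> S \<and> T s w = Z w)" for w
  define m where "m i s = (\<integral>x. g i s x \<partial>M i)" for i s
  define q where "q i s = (\<integral>x. (g i s x)\<^sup>2 \<partial>M i)" for i s
  have T[measurable]: "T s \<in> borel_measurable (PiM I M)" if "s \<in> S" for s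
    unfolding T_def using that g by (intro borel_measurable_sum) (auto intro!: measurable_compose[OF measurable_component_singleton])
  have Zm[measurable]: "Z \<in> borel_measurable (PiM I M)"
    unfolding Z_T[abs_def] using S(1) T by (intro borel_measurable_Max)
  have fm[measurable]: "f \<in> borel_measurable (PiM I M)" unfolding f_def by measurable
  have "\<exists>s. s \<in> S \<and> T s w = Z w" for w
    using Max_in[of "(\<lambda>s. T s w) ` S"] S unfolding Z_T by fastforce
  then have \<tau>: "\<tau> w \<in> S \<and> T (\<tau> w) w = Z w" for w
    unfolding \<tau>_def by (rule LeastI_ex)
  have T_le: "T s w \<le> Z w" if "s \<in> S" for s w
    unfolding Z_T using S that by (intro Max_ge) auto
  have "Measurable.pred (PiM I M) (\<lambda>w. s \<in> S \<and> T s w = Z w)" for s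
  proof (cases "s \<in> S")
    case True
    then show ?thesis using borel_measurable_eq[OF T[OF True] Zm] by (simp add: pred_def)
  qed simp
  then have "\<tau> \<in> PiM I M \<rightarrow>\<^sub>M count_space UNIV"
    unfolding \<tau>_def by measurable
  then have \<tau>m: "\<tau> \<in> PiM I M \<rightarrow>\<^sub>M count_space S"
    using \<tau> by (auto simp: measurable_count_space_eq2_countable)
  have comp: "w i \<in> space (M i)" if "w \<in> space (PiM I M)" "i \<in> I" for w i
    using that by (auto simp: space_PiM)
  have upd: "w(k := x) \<in> space (PiM I M)" if "w \<in> space (PiM I M)" "k \<in> I" "x \<in> space (M k)" for w k x
    using that by (auto simp: space_PiM PiE_iff extensional_def)
  have mupd: "(\<lambda>x. w(k := x)) \<in> M k \<rightarrow>\<^sub>M PiM I M" if "w \<in> space (PiM I M)" "k \<in> I" for w k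
    using measurable_fun_upd[of I I k "\<lambda>_. w" "M k" M "\<lambda>x. x"] that by (simp add: insert_absorb)
  define B where "B = real (card I) * b"
  have B0: "0 \<le> B" using b0 by (simp add: B_def)
  have ZB: "\<bar>Z w\<bar> \<le> B" if w: "w \<in> space (PiM I M)" for w
  proof -
    have "\<bar>T (\<tau> w) w\<bar> \<le> (\<Sum>i\<in>I. \<bar>g i (\<tau> w) (w i)\<bar>)" unfolding T_def by (rule sum_abs)
    also have "\<dots> \<le> (\<Sum>i\<in>I. b)" using gb comp[OF w] \<tau> by (intro sum_mono) auto
    finally show ?thesis using \<tau>[of w] by (simp add: B_def)
  qed
  have tZ: "\<bar>t * Z w\<bar> \<le> \<bar>t\<bar> * B" if "w \<in> space (PiM I M)" for w
    using ZB[OF that] by (simp add: abs_mult mult_left_mono)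
  have fb: "exp (- (\<bar>t\<bar> * B)) \<le> f w" "f w \<le> exp (\<bar>t\<bar> * B)" if "w \<in> space (PiM I M)" for w
    using tZ[OF that] by (auto simp: f_def abs_le_iff)
  have f0: "0 < f w" for w by (simp add: f_def)
  have mb: "\<bar>m i s\<bar> \<le> b" if "i \<in> I" "s \<in> S" for i s
    using M.integral_between[OF g[OF that], of "- b" b] gb[OF that]
    by (force simp: m_def abs_le_iff)
  have sqb: "(g i s x)\<^sup>2 \<le> b\<^sup>2" if "i \<in> I" "s \<in> S" "x \<in> space (M i)" for i s x
    using gb[OF that] b0 by (intro power2_le_iff_abs_le[THEN iffD2]) auto
  have qb: "0 \<le> q i s" "q i s \<le> b\<^sup>2" if "i \<in> I" "s \<in> S" for i s
    using M.integral_between[of "\<lambda>x. (g i s x)\<^sup>2" i 0 "b\<^sup>2"] sqb[OF that] g[OF that]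
    by (auto simp: q_def)
  define U where "U k w = f w * (8 * b * (g k (\<tau> w) (w k) - m k (\<tau> w)) + q k (\<tau> w))" for k w
  have Um: "U k \<in> borel_measurable (PiM I M)" if k: "k \<in> I" for k
  proof -
    have [measurable]: "(\<lambda>w. g k (\<tau> w) (w k)) \<in> borel_measurable (PiM I M)"
      using g[OF k] k
      by (intro measurable_compose_countable'[OF _ \<tau>m, where f="\<lambda>s w. g k s (w k)"])
        (auto intro!: measurable_compose[OF measurable_component_singleton])
    have [measurable]: "(\<lambda>w. m k (\<tau> w)) \<in> borel_measurable (PiM I M)"
        "(\<lambda>w. q k (\<tau> w)) \<in> borel_measurable (PiM I M)"
      by (rule measurable_compose[OF \<tau>m], simp)+
    show ?thesis unfolding U_def by measurable
  qed
  have Ub: "\<bar>U k w\<bar> \<le> exp (\<bar>t\<bar> * B) * (8 * b * (2 * b) + b\<^sup>2)"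
    if k: "k \<in> I" and w: "w \<in> space (PiM I M)" for k w
  proof -
    have s: "\<tau> w \<in> S" using \<tau> by auto
    have "\<bar>8 * b * (g k (\<tau> w) (w k) - m k (\<tau> w))\<bar> \<le> 8 * b * (2 * b)"
      using gb[OF k s comp[OF w k]] mb[OF k s] b0 unfolding abs_mult by (intro mult_mono) auto
    then have "\<bar>8 * b * (g k (\<tau> w) (w k) - m k (\<tau> w)) + q k (\<tau> w)\<bar> \<le> 8 * b * (2 * b) + b\<^sup>2"
      using qb[OF k s] by linarith
    then show ?thesis
      unfolding U_def abs_mult[of "f w"] using fb[OF w] f0[of w] by (intro mult_mono) auto
  qed
  have iU: "integrable (PiM I M) (U k)" if "k \<in> I" for k
    using Um[OF that] Ub[OF that] by (rule P.integrable_bounded)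
  have coord: "Ent (M k) (\<lambda>x. f (w(k := x))) \<le> (9/8) * t\<^sup>2 * (\<integral>x. U k (w(k := x)) \<partial>M k)"
    if k: "k \<in> I" and w: "w \<in> space (PiM I M)" for k w
  proof -
    define c where "c s = (\<Sum>i\<in>I-{k}. g i s (w i))" for s
    have Tc: "T s (w(k := x)) = c s + g k s x" for s x
      unfolding T_def c_def using I k by (subst sum.remove[of _ k]) auto
    show ?thesis
      unfolding f_def U_def m_def q_def fun_upd_same
    proof (rule M.Ent_exp_max_le[where c=c and S=S])
      show "(\<lambda>x. Z (w(k := x))) \<in> borel_measurable (M k)"
        using measurable_compose[OF mupd[OF w k] Zm] .
      show "(\<lambda>x. \<tau> (w(k := x))) \<in> M k \<rightarrow>\<^sub>M count_space S"
        using measurable_compose[OF mupd[OF w k] \<tau>m] .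
      show "c s + g k s x \<le> Z (w(k := x))" if "s \<in> S" for s x
        using T_le[OF that, of "w(k := x)"] by (simp add: Tc)
      show "Z (w(k := x)) = c (\<tau> (w(k := x))) + g k (\<tau> (w(k := x))) x" for x
        using \<tau>[of "w(k := x)"] by (simp add: Tc)
    qed (use g gb k t in auto)
  qed
  have "Ent (PiM I M) f \<le> (\<Sum>k\<in>I. \<integral>w. Ent (M k) (\<lambda>x. f (w(k := x))) \<partial>PiM I M)"
    by (rule Ent_tensorization[OF I fm _ fb]) auto
  also have "\<dots> \<le> (\<Sum>k\<in>I. (9/8) * t\<^sup>2 * (\<integral>w. U k w \<partial>PiM I M))"
  proof (rule sum_mono)
    fix k assume k: "k \<in> I"
    have "(\<integral>w. Ent (M k) (\<lambda>x. f (w(k := x))) \<partial>PiM I M)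
        \<le> (\<integral>w. (9/8) * t\<^sup>2 * (\<integral>x. U k (w(k := x)) \<partial>M k) \<partial>PiM I M)"
    proof (rule integral_mono')
      show "integrable (PiM I M) (\<lambda>w. (9/8) * t\<^sup>2 * (\<integral>x. U k (w(k := x)) \<partial>M k))"
        using integral_resample(2)[OF I k Um[OF k] Ub[OF k]] by simp
      fix w assume w: "w \<in> space (PiM I M)"
      show "Ent (M k) (\<lambda>x. f (w(k := x))) \<le> (9/8) * t\<^sup>2 * (\<integral>x. U k (w(k := x)) \<partial>M k)"
        by (rule coord[OF k w])
      \<comment> \<open>Nonnegativity of the majorant lets the integrals be compared without
        integrability of the left integrand.\<close>
      have "0 \<le> Ent (M k) (\<lambda>x. f (w(k := x)))"
        using fb upd[OF w k] measurable_compose[OF mupd[OF w k] fm]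
        by (intro M.Ent_nonneg[where a="exp (- (\<bar>t\<bar> * B))"]) auto
      then show "0 \<le> (9/8) * t\<^sup>2 * (\<integral>x. U k (w(k := x)) \<partial>M k)"
        using coord[OF k w] by linarith
    qed
    also have "\<dots> = (9/8) * t\<^sup>2 * (\<integral>w. U k w \<partial>PiM I M)"
      using integral_resample(1)[OF I k Um[OF k] Ub[OF k]] by simp
    finally show "(\<integral>w. Ent (M k) (\<lambda>x. f (w(k := x))) \<partial>PiM I M) \<le> (9/8) * t\<^sup>2 * (\<integral>w. U k w \<partial>PiM I M)" .
  qed
  also have "\<dots> = (9/8) * t\<^sup>2 * (\<integral>w. (\<Sum>k\<in>I. U k w) \<partial>PiM I M)"
    using iU by (simp add: sum_distrib_left)
  also have "\<dots> \<le> (9/8) * t\<^sup>2 * (\<integral>w. 8 * b * (f w * Z w + e * f w) + v * f w \<partial>PiM I M)"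
  proof (intro mult_left_mono integral_mono)
    have "integrable (PiM I M) f"
      using fb f0 by (intro P.integrable_bounded[where B="exp (\<bar>t\<bar> * B)"]) (auto simp: less_imp_le)
    moreover have "integrable (PiM I M) (\<lambda>w. f w * Z w)"
      using fb f0 ZB by (intro P.integrable_bounded[where B="exp (\<bar>t\<bar> * B) * B"])
        (auto simp: less_imp_le abs_mult intro!: mult_mono)
    ultimately show "integrable (PiM I M) (\<lambda>w. 8 * b * (f w * Z w + e * f w) + v * f w)" by simp
    show "integrable (PiM I M) (\<lambda>w. \<Sum>k\<in>I. U k w)" using iU by simp
    fix w assume w: "w \<in> space (PiM I M)"
    have s: "\<tau> w \<in> S" "T (\<tau> w) w = Z w" using \<tau> by auto
    \<comment> \<open>Every \<open>U k w\<close> uses the index \<open>\<tau> w\<close>, so the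
      values \<open>g k (\<tau> w) (w k)\<close> sum to \<open>T (\<tau> w) w = Z w\<close>, and the
      hypotheses on \<open>e\<close> and \<open>v\<close> apply to this single index.\<close>
    have "(\<Sum>k\<in>I. U k w) = f w * (8 * b * (T (\<tau> w) w + - (\<Sum>k\<in>I. m k (\<tau> w))) + (\<Sum>k\<in>I. q k (\<tau> w)))"
      unfolding U_def T_def by (simp add: sum_distrib_left sum.distrib sum_subtractf algebra_simps)
    also have "\<dots> \<le> f w * (8 * b * (Z w + e) + v)"
      using b0 f0[of w] s(2) e[OF s(1)] v[OF s(1)]
      by (intro mult_left_mono add_mono) (auto simp: m_def q_def)
    also have "\<dots> = 8 * b * (f w * Z w + e * f w) + v * f w" by (simp add: algebra_simps)
    finally show "(\<Sum>k\<in>I. U k w) \<le> 8 * b * (f w * Z w + e * f w) + v * f w" .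
  qed auto
  also have "(\<integral>w. 8 * b * (f w * Z w + e * f w) + v * f w \<partial>PiM I M)
     = 8 * b * ((\<integral>w. f w * Z w \<partial>PiM I M) + e * (\<integral>w. f w \<partial>PiM I M)) + v * (\<integral>w. f w \<partial>PiM I M)"
  proof -
    have "integrable (PiM I M) f"
      using fb f0 by (intro P.integrable_bounded[where B="exp (\<bar>t\<bar> * B)"]) (auto simp: less_imp_le)
    moreover have "integrable (PiM I M) (\<lambda>w. f w * Z w)"
      using fb f0 ZB by (intro P.integrable_bounded[where B="exp (\<bar>t\<bar> * B) * B"])
        (auto simp: less_imp_le abs_mult intro!: mult_mono)
    ultimately show ?thesis by simp
  qed
  finally show ?thesis unfolding f_def[abs_def] .
qed

section \<open>Moment bounds for bounded summands\<close>

text \<open>The remainder \<open>exp u - 1 - u\<close> with \<open>u = h * Y x\<close> is quadratic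
  in \<open>h\<close> uniformly in \<open>x\<close>, so the difference quotient converges after
  integration. The radius \<open>1 / (5 * (B + 1))\<close> keeps \<open>u\<close> below 1/5, where
  the quadratic bound for the exponential holds.\<close>

lemma (in prob_space) mgf_has_derivative:
  fixes Y :: "'a \<Rightarrow> real"
  assumes Y[measurable]: "Y \<in> borel_measurable M" and YB: "\<And>x. x \<in> space M \<Longrightarrow> \<bar>Y x\<bar> \<le> B"
  shows "((\<lambda>t. \<integral>x. exp (t * Y x) \<partial>M) has_real_derivative (\<integral>x. exp (t * Y x) * Y x \<partial>M)) (at t)"
proof -
  define F where "F t = (\<integral>x. exp (t * Y x) \<partial>M)" for t
  define D where "D = (\<integral>x. exp (t * Y x) * Y x \<partial>M)"
  obtain x1 where x1: "x1 \<in> space M" using not_empty by auto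
  have B0: "0 \<le> B" using YB[OF x1] by linarith
  have eb: "exp (t * Y x) \<le> exp (\<bar>t\<bar> * B)" if "x \<in> space M" for x t
  proof -
    have "\<bar>t * Y x\<bar> \<le> \<bar>t\<bar> * B" using YB[OF that] by (simp add: abs_mult mult_left_mono)
    then show ?thesis by simp
  qed
  have i1: "integrable M (\<lambda>x. exp (t * Y x))" for t
    using eb by (intro integrable_bounded[where B="exp (\<bar>t\<bar> * B)"]) auto
  have i2: "integrable M (\<lambda>x. exp (t * Y x) * Y x)"
  proof (rule integrable_bounded[where B="exp (\<bar>t\<bar> * B) * B"])
    fix x assume x: "x \<in> space M"
    show "\<bar>exp (t * Y x) * Y x\<bar> \<le> exp (\<bar>t\<bar> * B) * B"
      unfolding abs_mult using eb[OF x] YB[OF x] by (intro mult_mono) auto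
  qed measurable
  define K where "K = exp (\<bar>t\<bar> * B) * B\<^sup>2"
  have bound: "\<bar>(F (t + h) - F t) / h - D\<bar> \<le> K * \<bar>h\<bar>" if h: "h \<noteq> 0" "\<bar>h\<bar> < 1 / (5 * (B + 1))" for h
  proof -
    have hB: "\<bar>h\<bar> * B \<le> 1/5"
    proof -
      have "\<bar>h\<bar> * (5 * (B + 1)) \<le> 1" using h(2) B0 by (simp add: field_simps)
      then show ?thesis by (simp add: algebra_simps)
    qed
    have pt: "\<bar>exp ((t + h) * Y x) - exp (t * Y x) - h * (exp (t * Y x) * Y x)\<bar> \<le> K * h\<^sup>2"
      if x: "x \<in> space M" for x
    proof -
      define u where "u = h * Y x"
      have ub: "\<bar>u\<bar> \<le> \<bar>h\<bar> * B" using YB[OF x] by (simp add: u_def abs_mult mult_left_mono)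
      have "0 \<le> exp u - 1 - u" using exp_ge_add_one_self[of u] by linarith
      moreover have "exp u - 1 - u \<le> (81/100) * u\<^sup>2" using exp_le_quadratic[of u] ub hB by linarith
      ultimately have "\<bar>exp u - 1 - u\<bar> \<le> u\<^sup>2" using zero_le_power2[of u] by linarith
      also have "\<dots> \<le> (\<bar>h\<bar> * B)\<^sup>2" using ub by (intro power2_le_iff_abs_le[THEN iffD2]) auto
      finally have "exp (t * Y x) * \<bar>exp u - 1 - u\<bar> \<le> exp (\<bar>t\<bar> * B) * (\<bar>h\<bar> * B)\<^sup>2"
        using eb[OF x] by (intro mult_mono) auto
      moreover have "exp ((t + h) * Y x) - exp (t * Y x) - h * (exp (t * Y x) * Y x) = exp (t * Y x) * (exp u - 1 - u)"
        by (simp add: u_def algebra_simps exp_add)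
      ultimately show ?thesis by (simp add: abs_mult K_def power_mult_distrib mult.commute mult.left_commute)
    qed
    have "F (t + h) - F t - h * D = (\<integral>x. exp ((t + h) * Y x) - exp (t * Y x) - h * (exp (t * Y x) * Y x) \<partial>M)"
      using i1 i2 by (simp add: F_def D_def)
    also have "\<bar>\<dots>\<bar> \<le> K * h\<^sup>2"
    proof -
      have "(\<lambda>x. exp ((t + h) * Y x) - exp (t * Y x) - h * (exp (t * Y x) * Y x)) \<in> borel_measurable M"
        by measurable
      from integral_between[OF this, of "- (K * h\<^sup>2)" "K * h\<^sup>2"] pt show ?thesis
        by (force simp: abs_le_iff)
    qed
    finally have "\<bar>F (t + h) - F t - h * D\<bar> / \<bar>h\<bar> \<le> K * h\<^sup>2 / \<bar>h\<bar>"
      by (intro divide_right_mono) auto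
    moreover have "(F (t + h) - F t) / h - D = (F (t + h) - F t - h * D) / h"
      using h(1) by (simp add: field_simps)
    moreover have "K * h\<^sup>2 / \<bar>h\<bar> = K * \<bar>h\<bar>" using h(1) by (simp add: power2_eq_square field_simps abs_if)
    ultimately show ?thesis by (simp add: abs_divide)
  qed
  have "((\<lambda>h. (F (t + h) - F t) / h - D) \<longlongrightarrow> 0) (at 0)"
  proof (rule Lim_null_comparison)
    have "\<forall>\<^sub>F h in at 0. h \<noteq> 0 \<and> \<bar>h\<bar> < 1 / (5 * (B + 1))"
      using B0 by (auto simp: eventually_at intro!: exI[of _ "1 / (5 * (B + 1))"])
    then show "\<forall>\<^sub>F h in at 0. norm ((F (t + h) - F t) / h - D) \<le> K * \<bar>h\<bar>"
      by (rule eventually_mono) (auto intro!: bound)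
    show "((\<lambda>h. K * \<bar>h\<bar>) \<longlongrightarrow> 0) (at 0)"
      by (auto intro!: tendsto_eq_intros)
  qed
  then have "((\<lambda>h. (F (t + h) - F t) / h) \<longlongrightarrow> D) (at 0)" by (simp add: LIM_zero_iff)
  then show ?thesis by (simp add: DERIV_def F_def D_def)
qed

text \<open>The sign \<open>r\<close> is \<open>1\<close> for the upper tail (\<open>Y = Z\<close>) and \<open>- 1\<close> for the lower tail (\<open>Y = - Z\<close>).\<close>
lemma (in prob_space) Herbst:
  fixes Y :: "'a \<Rightarrow> real" and r e \<beta> u t0 :: real
  assumes Y[measurable]: "Y \<in> borel_measurable M" and YB: "\<And>x. x \<in> space M \<Longrightarrow> \<bar>Y x\<bar> \<le> B"
    and t0: "0 < t0"
    and ent: "\<And>t. 0 < t \<Longrightarrow> t \<le> t0 \<Longrightarrow> Ent M (\<lambda>x. exp (t * Y x)) \<le>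
      t\<^sup>2 * (\<beta> * (r * (\<integral>x. exp (t * Y x) * Y x \<partial>M) + e * (\<integral>x. exp (t * Y x) \<partial>M))
           + u * (\<integral>x. exp (t * Y x) \<partial>M))"
  defines "L \<equiv> ln (\<integral>x. exp (t0 * Y x) \<partial>M)"
  shows "L \<le> t0 * expectation Y + t0 * \<beta> * r * L + (\<beta> * e + u) * t0\<^sup>2"
proof -
  define F where "F t = (\<integral>x. exp (t * Y x) \<partial>M)" for t
  define D where "D t = (\<integral>x. exp (t * Y x) * Y x \<partial>M)" for t
  have eb: "exp (t * Y x) \<le> exp (\<bar>t\<bar> * B)" "exp (- (\<bar>t\<bar> * B)) \<le> exp (t * Y x)" if "x \<in> space M" for x t
  proof -
    have "\<bar>t * Y x\<bar> \<le> \<bar>t\<bar> * B" using YB[OF that] by (auto simp: abs_mult intro!: mult_left_mono)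
    then show "exp (t * Y x) \<le> exp (\<bar>t\<bar> * B)" "exp (- (\<bar>t\<bar> * B)) \<le> exp (t * Y x)" by auto
  qed
  have i1: "integrable M (\<lambda>x. exp (t * Y x))" for t
    using eb by (intro integrable_bounded[where B="exp (\<bar>t\<bar> * B)"]) auto
  have i2: "integrable M (\<lambda>x. exp (t * Y x) * Y x)" for t
  proof (rule integrable_bounded[where B="exp (\<bar>t\<bar> * B) * B"])
    fix x assume x: "x \<in> space M"
    show "\<bar>exp (t * Y x) * Y x\<bar> \<le> exp (\<bar>t\<bar> * B) * B"
      unfolding abs_mult using eb[OF x] YB[OF x] by (intro mult_mono) auto
  qed measurable
  have F0: "0 < F t" for t
    using integral_between(1)[of "\<lambda>x. exp (t * Y x)" "exp (- (\<bar>t\<bar> * B))" "exp (\<bar>t\<bar> * B)"] eb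
    by (auto simp: F_def intro: less_le_trans[OF exp_gt_zero])
  have dF: "(F has_real_derivative D t) (at t)" for t
    unfolding F_def[abs_def] D_def by (rule mgf_has_derivative[OF Y YB])
  define l where "l t = ln (F t)" for t
  have dl: "(l has_real_derivative D t / F t) (at t)" for t
    unfolding l_def[abs_def] using dF[of t] F0[of t]
    by (auto intro!: derivative_eq_intros simp: field_simps)
  have EntF: "Ent M (\<lambda>x. exp (t * Y x)) = t * D t - F t * l t" for t
  proof -
    have "(\<integral>x. exp (t * Y x) * ln (exp (t * Y x)) \<partial>M) = (\<integral>x. t * (exp (t * Y x) * Y x) \<partial>M)"
      by (intro Bochner_Integration.integral_cong) auto
    then show ?thesis using i2 by (simp add: Ent_def F_def D_def l_def)
  qed
  \<comment> \<open>The derivative of \<open>l t / t\<close> is the entropy divided by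
    \<open>F t * t^2\<close>, and \<open>D t / F t\<close> is the derivative of \<open>l\<close>.
    Divided by \<open>F t * t^2\<close>, the entropy hypothesis therefore says exactly that
    \<open>G\<close> has derivative at most 0. The \<open>Y\<close> term is integrated exactly,
    which is why \<open>L\<close> occurs on both sides of the conclusion.\<close>
  define G where "G t = l t / t - \<beta> * r * l t - (\<beta> * e + u) * t" for t
  have mono: "G t0 \<le> G d" if d: "0 < d" "d \<le> t0" for d
  proof (rule DERIV_nonpos_imp_nonincreasing[where f=G, OF d(2)])
    fix x assume x: "d \<le> x" "x \<le> t0"
    then have x0: "0 < x" using d by simp
    let ?d = "(D x / F x * x - l x) / x\<^sup>2 - \<beta> * r * (D x / F x) - (\<beta> * e + u)"
    have "(G has_real_derivative ?d) (at x)"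
      unfolding G_def[abs_def] using x0 dl[of x]
      by (auto intro!: derivative_eq_intros simp: power2_eq_square)
    moreover have "?d \<le> 0"
    proof -
      have "x * D x - F x * l x \<le> x\<^sup>2 * (\<beta> * (r * D x + e * F x) + u * F x)"
        using ent[OF x0 x(2)] unfolding EntF by (simp add: F_def D_def)
      then have "(x * D x - F x * l x) / (F x * x\<^sup>2) \<le> x\<^sup>2 * (\<beta> * (r * D x + e * F x) + u * F x) / (F x * x\<^sup>2)"
        using F0[of x] x0 by (intro divide_right_mono) auto
      also have "\<dots> = \<beta> * r * (D x / F x) + (\<beta> * e + u)"
        using F0[of x] x0 by (simp add: field_simps)
      also have "(x * D x - F x * l x) / (F x * x\<^sup>2) = (D x / F x * x - l x) / x\<^sup>2"
        using F0[of x] x0 by (simp add: field_simps)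
      finally show ?thesis by simp
    qed
    ultimately show "\<exists>y. (G has_real_derivative y) (at x) \<and> y \<le> 0" by blast
  qed
  have l0: "l 0 = 0" by (simp add: l_def F_def prob_space)
  have D0: "D 0 / F 0 = expectation Y" by (simp add: D_def F_def prob_space)
  have "((\<lambda>h. (l (0 + h) - l 0) / h) \<longlongrightarrow> D 0 / F 0) (at 0)"
    using dl[of 0] by (simp add: DERIV_def)
  then have lim1: "((\<lambda>h. l h / h) \<longlongrightarrow> expectation Y) (at 0)" by (simp add: l0 D0)
  have lim2: "(l \<longlongrightarrow> 0) (at 0)"
    using DERIV_isCont[OF dl[of 0]] by (simp add: isCont_def l0)
  \<comment> \<open>Near 0 only \<open>l t / t\<close> contributes, and it tends to the derivative
    of \<open>l\<close> at 0, the mean of \<open>Y\<close>.\<close>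
  have "(G \<longlongrightarrow> expectation Y - \<beta> * r * 0 - (\<beta> * e + u) * 0) (at 0)"
    unfolding G_def[abs_def] by (intro tendsto_intros lim1 lim2)
  then have "(G \<longlongrightarrow> expectation Y) (at_right 0)"
    by (simp add: filterlim_at_split)
  moreover have "\<forall>\<^sub>F d in at_right 0. G t0 \<le> G d"
    using t0 by (auto simp: eventually_at_right_field intro!: exI[of _ t0] mono)
  ultimately have "G t0 \<le> expectation Y"
    by (rule tendsto_lowerbound) simp
  then have "t0 * G t0 \<le> t0 * expectation Y" using t0 by (intro mult_left_mono) auto
  moreover have "t0 * G t0 = L - t0 * \<beta> * r * L - (\<beta> * e + u) * t0\<^sup>2"
    using t0 by (simp add: G_def L_def l_def F_def power2_eq_square algebra_simps)
  ultimately show ?thesis by simp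
qed

text \<open>The pointwise bound is \<open>z \<le> exp (z - 1)\<close> at
  \<open>z = t * y / l\<close>. With \<open>1 / t = 2 * T\<close> and the allowance
  \<open>l / 4\<close> for the logarithm, the integral is at most the l-th power of
  \<open>2 * l * T * exp (- 3/4)\<close>, and 2 \<le> exp (3/4) removes both constants.\<close>

lemma (in prob_space) nn_integral_pos_pow_le:
  fixes Y :: "'a \<Rightarrow> real" and t l K :: real
  assumes t: "0 < t" and l: "1 \<le> l" and i: "integrable M (\<lambda>x. exp (t * Y x))"
    and K: "ln (\<integral>x. exp (t * Y x) \<partial>M) \<le> l / 4" and T: "2 * t * T = 1"
  shows "(\<integral>\<^sup>+x. ennreal (pos_pow (Y x) l) \<partial>M) \<le> ennreal ((l * T) powr l)"
proof -
  have T0: "0 < T" using T t by (metis mult_pos_pos zero_less_mult_pos zero_less_numeral zero_less_one)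
  have pt: "pos_pow y l \<le> (2 * l * T / exp 1) powr l * exp (t * y)" for y
  proof (cases "0 < y")
    case True
    have "t * y / l \<le> exp (t * y / l - 1)" using exp_ge_add_one_self[of "t * y / l - 1"] by simp
    then have "y \<le> (l / t) * exp (t * y / l - 1)" using t l by (simp add: field_simps)
    also have "l / t = 2 * l * T" using T t by (simp add: field_simps)
    finally have "y \<le> (2 * l * T / exp 1) * exp (t * y / l)" by (simp add: exp_diff)
    then have "y powr l \<le> ((2 * l * T / exp 1) * exp (t * y / l)) powr l"
      using True l by (intro powr_mono2) auto
    also have "\<dots> = (2 * l * T / exp 1) powr l * exp (t * y / l) powr l"
      using T0 l by (intro powr_mult)
    also have "exp (t * y / l) powr l = exp (t * y)" using l by (simp add: powr_def)
    finally show ?thesis using True by (simp add: pos_pow_def)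
  qed (simp add: pos_pow_def)
  define C where "C = (2 * l * T / exp 1) powr l"
  have "(\<integral>\<^sup>+x. ennreal (pos_pow (Y x) l) \<partial>M) \<le> (\<integral>\<^sup>+x. ennreal (C * exp (t * Y x)) \<partial>M)"
    by (intro nn_integral_mono ennreal_leI) (auto simp: C_def pt)
  also have "\<dots> = ennreal (\<integral>x. C * exp (t * Y x) \<partial>M)"
    using i by (intro nn_integral_eq_integral) (auto simp: C_def)
  also have "\<dots> \<le> ennreal ((l * T) powr l)"
  proof (rule ennreal_leI)
    have "0 \<le> (\<integral>x. exp (t * Y x) \<partial>M)" by simp
    \<comment> \<open>Because \<open>ln 0 = 0\<close>, the hypothesis on the logarithm carries
      information only for a positive integral; for the value 0 the claim is immediate.\<close>
    then have "(\<integral>x. exp (t * Y x) \<partial>M) \<le> exp (l / 4)"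
    proof (cases "(\<integral>x. exp (t * Y x) \<partial>M) = 0")
      case False
      then have "0 < (\<integral>x. exp (t * Y x) \<partial>M)" using \<open>0 \<le> _\<close> by linarith
      then show ?thesis using K by (metis exp_le_cancel_iff exp_ln)
    qed simp
    then have "(\<integral>x. C * exp (t * Y x) \<partial>M) \<le> C * exp (l / 4)"
      by (simp add: C_def mult_left_mono)
    also have "exp (l / 4) = exp (1/4) powr l" by (simp add: powr_def)
    also have "C * exp (1/4) powr l = (2 * l * T / exp 1 * exp (1/4)) powr l"
      unfolding C_def using T0 l by (intro powr_mult[symmetric])
    also have "\<dots> \<le> (l * T) powr l"
    proof (rule powr_mono2)
      have "1 + 3/4 + (3/4)\<^sup>2/2 \<le> exp (3/4::real)" by (rule exp_lower_Taylor_quadratic) simp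
      then have "2 \<le> exp (3/4::real)" by (simp add: power2_eq_square)
      moreover have "exp 1 = exp (3/4) * exp (1/4::real)" by (simp add: exp_add[symmetric])
      ultimately have "2 * exp (1/4) \<le> exp (1::real)" by simp
      then have "(l * T) * (2 * exp (1/4)) \<le> (l * T) * exp 1" using T0 l by (intro mult_left_mono) auto
      then show "2 * l * T / exp 1 * exp (1/4) \<le> l * T" by (simp add: field_simps)
    qed (use T0 l in auto)
    finally show "(\<integral>x. C * exp (t * Y x) \<partial>M) \<le> (l * T) powr l" .
  qed
  finally show ?thesis .
qed

text \<open>\<open>T\<close> is the claimed moment bound divided by \<open>l\<close>, and
  \<open>t = 1 / (2 * T)\<close>. Since \<open>T\<close> dominates each of its two summands, the
  first yields the linear constraint on \<open>t * b\<close> and the second the quadratic constraint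
  on \<open>v\<close>.\<close>

lemma tuning_parameter:
  fixes A a b v l :: real
  assumes "0 < A" "0 < b" "0 \<le> a" "0 \<le> v" "1 \<le> l"
  obtains t T where "0 < t" "2 * t * T = 1" "2 * A * (t * b) \<le> 1" "4 * a\<^sup>2 * (t\<^sup>2 * v) \<le> l"
    "l * T = A * (l * b) + a * sqrt l * sqrt v"
proof -
  define T where "T = A * b + a * sqrt (v / l)"
  define t where "t = 1 / (2 * T)"
  have Ab: "0 < A * b" and as: "0 \<le> a * sqrt (v / l)" using assms by auto
  have T: "0 < T" using Ab as by (simp add: T_def)
  have "2 * A * (t * b) = (A * b) / T" by (simp add: t_def)
  also have "\<dots> \<le> 1" using T as by (simp add: T_def)
  finally have 1: "2 * A * (t * b) \<le> 1" .
  have "a\<^sup>2 * (v / l) = (a * sqrt (v / l))\<^sup>2" using assms by (simp add: power_mult_distrib)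
  also have "\<dots> \<le> T\<^sup>2" using Ab as by (intro power_mono) (auto simp: T_def)
  finally have "a\<^sup>2 * v \<le> l * T\<^sup>2" using assms by (simp add: field_simps)
  then have 2: "4 * a\<^sup>2 * (t\<^sup>2 * v) \<le> l" using T by (simp add: t_def power_divide field_simps)
  have "l * sqrt (v / l) = sqrt l * sqrt v"
  proof -
    have "l * sqrt (v / l) = (l / sqrt l) * sqrt v" by (simp add: real_sqrt_divide)
    also have "l / sqrt l = sqrt l" using assms by (simp add: real_div_sqrt)
    finally show ?thesis .
  qed
  then have "l * T = A * (l * b) + a * sqrt l * sqrt v"
    by (simp add: T_def algebra_simps)
  then show ?thesis using that[of t T] T 1 2 by (simp add: t_def)
qed

text \<open>Here \<open>\<theta>\<close> stands for \<open>t * b\<close>. Solving for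
  \<open>L\<close> gives \<open>t * E\<close> the coefficient
  \<open>18 * \<theta> - \<epsilon> * (1 - 9 * \<theta>)\<close>, which the constraint on
  \<open>\<theta>\<close> makes nonpositive. The same constraint gives
  \<open>\<theta> \<le> 1/10\<close>, so dividing by \<open>1 - 9 * \<theta>\<close> costs at most a
  factor 10, and 10 * 9/8 is below 16.\<close>

lemma upper_exponent_le:
  fixes t E v \<epsilon> \<theta> L :: real
  assumes t: "0 < t" and E: "0 \<le> E" and v: "0 \<le> v" and \<epsilon>: "0 < \<epsilon>" and \<theta>: "0 \<le> \<theta>" "2 * (64 / \<epsilon> + 5) * \<theta> \<le> 1"
    and L: "L \<le> t * E + 9 * \<theta> * L + (9 * \<theta> * (t * E) + 9/8 * (t\<^sup>2 * v))"
  shows "L - t * ((1 + \<epsilon>) * E) \<le> 16 * (t\<^sup>2 * v)"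
proof -
  have "128 * \<theta> + 10 * \<theta> * \<epsilon> \<le> \<epsilon>" using \<theta>(2) \<epsilon> by (simp add: field_simps)
  then have c1: "18 * \<theta> - \<epsilon> * (1 - 9 * \<theta>) \<le> 0"
    using \<theta>(1) \<epsilon> mult_nonneg_nonneg[OF \<theta>(1), of \<epsilon>] by (simp add: algebra_simps)
  have "0 \<le> 64 / \<epsilon> * \<theta>" using \<epsilon> \<theta> by simp
  then have c2: "1/10 \<le> 1 - 9 * \<theta>" using \<theta>(2) by (simp add: algebra_simps)
  have "(1 - 9 * \<theta>) * (L - t * ((1 + \<epsilon>) * E))
     \<le> (t * E) * (18 * \<theta> - \<epsilon> * (1 - 9 * \<theta>)) + 9/8 * (t\<^sup>2 * v)"
    using L by (simp add: algebra_simps)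
  also have "\<dots> \<le> 9/8 * (t\<^sup>2 * v)"
    using c1 t E by (simp add: mult_nonneg_nonpos)
  also have "\<dots> \<le> (1 - 9 * \<theta>) * 16 * (t\<^sup>2 * v)"
    using c2 v by (intro mult_right_mono) auto
  finally have "(1 - 9 * \<theta>) * (L - t * ((1 + \<epsilon>) * E)) \<le> (1 - 9 * \<theta>) * (16 * (t\<^sup>2 * v))" by (simp only: mult.assoc)
  then show ?thesis using c2 by (simp add: mult_le_cancel_left)
qed

text \<open>\<open>L\<close> enters the right side with a negative sign, so a lower bound on
  \<open>L\<close> is what helps. \<open>L'\<close>, which comes from Jensen's inequality, turns
  \<open>- 9 * \<theta> * L\<close> into at most \<open>9 * \<theta> * (t * E)\<close>; together
  with the other mean term this is \<open>18 * \<theta> * (t * E)\<close>, absorbed by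
  \<open>\<epsilon>\<close>.\<close>

lemma lower_exponent_le:
  fixes t E v \<epsilon> \<theta> L :: real
  assumes t: "0 < t" and E: "0 \<le> E" and v: "0 \<le> v" and \<epsilon>: "0 < \<epsilon>" and \<theta>: "0 \<le> \<theta>" "2 * (86.4 / \<epsilon> + 5) * \<theta> \<le> 1"
    and L: "L \<le> - (t * E) - 9 * \<theta> * L + (9 * \<theta> * (t * E) + 9/8 * (t\<^sup>2 * v))" and L': "- (t * E) \<le> L"
  shows "L + t * ((1 - \<epsilon>) * E) \<le> 4.7\<^sup>2 * (t\<^sup>2 * v)"
proof -
  have "172.8 * \<theta> + 10 * \<theta> * \<epsilon> \<le> \<epsilon>" using \<theta>(2) \<epsilon> by (simp add: field_simps)
  moreover have "0 \<le> 10 * \<theta> * \<epsilon>" using \<theta>(1) \<epsilon> by simp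
  ultimately have c1: "18 * \<theta> \<le> \<epsilon>" using \<theta>(1) by linarith
  have "9 * \<theta> * - (t * E) \<le> 9 * \<theta> * L" using L' \<theta> by (intro mult_left_mono) auto
  then have "L \<le> - (t * E) + 18 * \<theta> * (t * E) + 9/8 * (t\<^sup>2 * v)" using L by (simp add: algebra_simps)
  also have "\<dots> \<le> - (t * E) + \<epsilon> * (t * E) + 4.7\<^sup>2 * (t\<^sup>2 * v)"
    using c1 t E v by (intro add_mono mult_right_mono) (auto simp: power2_eq_square)
  finally show ?thesis by (simp add: algebra_simps)
qed

section \<open>Upper and lower tails of maxima of bounded sums\<close>

context product_prob_space
begin

lemma bounded_Max_sum_concentration:
  fixes g :: "'i \<Rightarrow> nat \<Rightarrow> 'a \<Rightarrow> real" and S :: "nat set" and b v l \<epsilon> :: real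
  defines "Z \<equiv> \<lambda>w. Max ((\<lambda>s. \<Sum>i\<in>I. g i s (w i)) ` S)"
  defines "E \<equiv> (\<integral>w. Z w \<partial>PiM I M)"
  assumes I: "finite I" and S: "finite S" "S \<noteq> {}" and b0: "0 < b"
    and g: "\<And>i s. i \<in> I \<Longrightarrow> s \<in> S \<Longrightarrow> g i s \<in> borel_measurable (M i)"
    and gb: "\<And>i s x. i \<in> I \<Longrightarrow> s \<in> S \<Longrightarrow> x \<in> space (M i) \<Longrightarrow> \<bar>g i s x\<bar> \<le> b"
    and v: "\<And>s. s \<in> S \<Longrightarrow> (\<Sum>i\<in>I. \<integral>x. (g i s x)\<^sup>2 \<partial>M i) \<le> v"
    and e: "\<And>s. s \<in> S \<Longrightarrow> - (\<Sum>i\<in>I. \<integral>x. g i s x \<partial>M i) \<le> E"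
    and E0: "0 \<le> E" and l: "1 \<le> l" and \<epsilon>: "0 < \<epsilon>"
  shows bounded_Max_sum_upper: "(\<integral>\<^sup>+w. ennreal (pos_pow (Z w - (1 + \<epsilon>) * E) l) \<partial>PiM I M)
      \<le> ennreal (((64 / \<epsilon> + 5) * (l * b) + 4 * sqrt l * sqrt v) powr l)"
    and bounded_Max_sum_lower: "\<epsilon> \<le> 1 \<Longrightarrow> (\<integral>\<^sup>+w. ennreal (pos_pow ((1 - \<epsilon>) * E - Z w) l) \<partial>PiM I M)
      \<le> ennreal (((86.4 / \<epsilon> + 5) * (l * b) + 4.7 * sqrt l * sqrt v) powr l)"
proof -
  have v0: "0 \<le> v"
  proof -
    obtain s where "s \<in> S" using S by auto
    have "0 \<le> (\<Sum>i\<in>I. \<integral>x. (g i s x)\<^sup>2 \<partial>M i)" by (intro sum_nonneg) auto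
    then show ?thesis using v[OF \<open>s \<in> S\<close>] by simp
  qed
  have Zm[measurable]: "Z \<in> borel_measurable (PiM I M)"
    unfolding Z_def using S(1) g
    by (intro borel_measurable_Max borel_measurable_sum)
      (auto intro!: measurable_compose[OF measurable_component_singleton])
  define B where "B = real (card I) * b"
  have ZB: "\<bar>Z w\<bar> \<le> B" if w: "w \<in> space (PiM I M)" for w
  proof -
    have "Z w \<in> (\<lambda>s. \<Sum>i\<in>I. g i s (w i)) ` S" unfolding Z_def using S by (intro Max_in) auto
    then obtain s where s: "s \<in> S" "Z w = (\<Sum>i\<in>I. g i s (w i))" by auto
    have "\<bar>Z w\<bar> \<le> (\<Sum>i\<in>I. \<bar>g i s (w i)\<bar>)" unfolding s(2) by (rule sum_abs)
    also have "\<dots> \<le> (\<Sum>i\<in>I. b)" using gb s w by (intro sum_mono) (auto simp: space_PiM)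
    finally show ?thesis by (simp add: B_def)
  qed
  have iexp: "integrable (PiM I M) (\<lambda>w. exp (t * Z w))" for t
  proof (rule P.integrable_bounded[where B="exp (\<bar>t\<bar> * B)"])
    fix w assume "w \<in> space (PiM I M)"
    then have "\<bar>t * Z w\<bar> \<le> \<bar>t\<bar> * B" using ZB by (simp add: abs_mult mult_left_mono)
    then show "\<bar>exp (t * Z w)\<bar> \<le> exp (\<bar>t\<bar> * B)" by simp
  qed measurable
  have iZ: "integrable (PiM I M) Z" using ZB by (intro P.integrable_bounded) auto
  have Zw: "Max ((\<lambda>s. \<Sum>i\<in>I. g i s (w i)) ` S) = Z w" for w by (simp add: Z_def)
  note ent = Ent_exp_Max_sum_le[where g=g and S=S and b=b and v=v and e=E, OF I S less_imp_le[OF b0] g gb v e, unfolded Zw]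
  have shift: "ln (\<integral>w. exp (t * (r * Z w + c)) \<partial>PiM I M) = ln (\<integral>w. exp ((t * r) * Z w) \<partial>PiM I M) + t * c" for t r c
  proof -
    have "(\<integral>w. exp (t * (r * Z w + c)) \<partial>PiM I M) = (\<integral>w. exp ((t * r) * Z w) * exp (t * c) \<partial>PiM I M)"
      by (simp add: exp_add[symmetric] algebra_simps)
    also have "\<dots> = (\<integral>w. exp ((t * r) * Z w) \<partial>PiM I M) * exp (t * c)" by simp
    finally have eq: "(\<integral>w. exp (t * (r * Z w + c)) \<partial>PiM I M) = (\<integral>w. exp ((t * r) * Z w) \<partial>PiM I M) * exp (t * c)" .
    have "0 < (\<integral>w. exp ((t * r) * Z w) \<partial>PiM I M)"
      using P.integral_less_AE_space[of "\<lambda>_. 0" "\<lambda>w. exp ((t * r) * Z w)"] iexp by (simp add: P.emeasure_space_1)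
    then show ?thesis unfolding eq by (subst ln_mult) auto
  qed
  have iexp': "integrable (PiM I M) (\<lambda>w. exp (t * (r * Z w + c)))" for t r c
    using integrable_mult_left[OF iexp[of "t * r"], of "exp (t * c)"]
    by (simp add: exp_add[symmetric] algebra_simps)
  show "(\<integral>\<^sup>+w. ennreal (pos_pow (Z w - (1 + \<epsilon>) * E) l) \<partial>PiM I M)
      \<le> ennreal (((64 / \<epsilon> + 5) * (l * b) + 4 * sqrt l * sqrt v) powr l)"
  proof -
    have "0 < 64 / \<epsilon> + 5" using \<epsilon> by (simp add: add_pos_pos)
    then obtain t T where t: "0 < t" "2 * t * T = 1" "2 * (64 / \<epsilon> + 5) * (t * b) \<le> 1"
        "4 * 4\<^sup>2 * (t\<^sup>2 * v) \<le> l" "l * T = (64 / \<epsilon> + 5) * (l * b) + 4 * sqrt l * sqrt v"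
      using tuning_parameter[of "64 / \<epsilon> + 5" b 4 v l] b0 v0 l by auto
    have tb: "0 \<le> t * b" using t b0 by simp
    have "0 \<le> 64 / \<epsilon> * (t * b)" using \<epsilon> tb by simp
    moreover have "2 * (64 / \<epsilon> + 5) * (t * b) = 2 * (64 / \<epsilon> * (t * b)) + 10 * (t * b)"
      by (simp add: algebra_simps)
    \<comment> \<open>This is where the summand 5 in \<open>64 / \<epsilon> + 5\<close> is used: it
      bounds \<open>t * b\<close> even for large \<open>\<epsilon>\<close>.\<close>
    ultimately have tb10: "t * b \<le> 1/10" using t(3) by linarith
    define L where "L = ln (\<integral>w. exp (t * Z w) \<partial>PiM I M)"
    \<comment> \<open>The entropy bound has 9/8 * 8 * b = 9 * b before the terms with
      \<open>Z\<close> and its mean, and 9/8 * v before the remaining one; these are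
      \<open>\<beta>\<close> and \<open>u\<close> in Herbst's argument.\<close>
    have "L \<le> t * E + t * (9 * b) * 1 * L + (9 * b * E + 9/8 * v) * t\<^sup>2"
      unfolding L_def E_def
    proof (rule P.Herbst[OF Zm ZB t(1)])
      fix x assume x: "0 < x" "x \<le> t"
      then have "x * b \<le> t * b" using b0 by (intro mult_right_mono) auto
      then have "x * b \<le> 1/10" using tb10 by simp
      then show "Ent (PiM I M) (\<lambda>w. exp (x * Z w)) \<le> x\<^sup>2 *
         (9 * b * (1 * (\<integral>w. exp (x * Z w) * Z w \<partial>PiM I M) + (\<integral>w. Z w \<partial>PiM I M) * (\<integral>w. exp (x * Z w) \<partial>PiM I M))
           + 9/8 * v * (\<integral>w. exp (x * Z w) \<partial>PiM I M))"
        using ent[where t=x] x by (simp add: E_def algebra_simps)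
    qed
    then have "L - t * ((1 + \<epsilon>) * E) \<le> 16 * (t\<^sup>2 * v)"
      by (intro upper_exponent_le[OF t(1) E0 v0 \<epsilon> tb t(3)]) (simp add: algebra_simps power2_eq_square)
    then have "ln (\<integral>w. exp (t * (1 * Z w + - ((1 + \<epsilon>) * E))) \<partial>PiM I M) \<le> l / 4"
      unfolding shift using t(4) by (simp add: L_def)
    from P.nn_integral_pos_pow_le[OF t(1) l iexp' this t(2)] show ?thesis
      by (simp add: t(5))
  qed
  show "(\<integral>\<^sup>+w. ennreal (pos_pow ((1 - \<epsilon>) * E - Z w) l) \<partial>PiM I M)
      \<le> ennreal (((86.4 / \<epsilon> + 5) * (l * b) + 4.7 * sqrt l * sqrt v) powr l)" if \<epsilon>1: "\<epsilon> \<le> 1"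
  proof -
    have "0 < 86.4 / \<epsilon> + 5" using \<epsilon> by (simp add: add_pos_pos)
    then obtain t T where t: "0 < t" "2 * t * T = 1" "2 * (86.4 / \<epsilon> + 5) * (t * b) \<le> 1"
        "4 * 4.7\<^sup>2 * (t\<^sup>2 * v) \<le> l" "l * T = (86.4 / \<epsilon> + 5) * (l * b) + 4.7 * sqrt l * sqrt v"
      using tuning_parameter[of "86.4 / \<epsilon> + 5" b "4.7" v l] b0 v0 l by auto
    have tb: "0 \<le> t * b" using t b0 by simp
    \<comment> \<open>Here \<open>\<epsilon> \<le> 1\<close> enters: it makes \<open>t * b\<close>
      at most 1 / 172.8 uniformly in \<open>\<epsilon>\<close>, as the entropy bound for negative
      exponents demands.\<close>
    have "86.4 \<le> 86.4 / \<epsilon> + 5" using \<epsilon> \<epsilon>1 by (simp add: field_simps)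
    then have "2 * 86.4 * (t * b) \<le> 2 * (86.4 / \<epsilon> + 5) * (t * b)" using tb by (intro mult_right_mono) auto
    then have tb10: "t * b \<le> 1/172" using t(3) by simp
    define L where "L = ln (\<integral>w. exp (t * - Z w) \<partial>PiM I M)"
    have "L \<le> t * (\<integral>w. - Z w \<partial>PiM I M) + t * (9 * b) * (- 1) * L + (9 * b * E + 9/8 * v) * t\<^sup>2"
      unfolding L_def
    proof (rule P.Herbst[OF _ _ t(1)])
      show "(\<lambda>w. - Z w) \<in> borel_measurable (PiM I M)" by simp
      show "\<bar>- Z w\<bar> \<le> B" if "w \<in> space (PiM I M)" for w using ZB[OF that] by simp
      fix x assume x: "0 < x" "x \<le> t"
      then have "x * b \<le> t * b" using b0 by (intro mult_right_mono) auto
      then have "x * b \<le> 1/172" using tb10 by simp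
      then show "Ent (PiM I M) (\<lambda>w. exp (x * - Z w)) \<le> x\<^sup>2 *
         (9 * b * (- 1 * (\<integral>w. exp (x * - Z w) * - Z w \<partial>PiM I M) + E * (\<integral>w. exp (x * - Z w) \<partial>PiM I M))
           + 9/8 * v * (\<integral>w. exp (x * - Z w) \<partial>PiM I M))"
        using ent[where t="- x"] x by (simp add: algebra_simps)
    qed
    moreover have "- (t * E) \<le> L"
    proof -
      \<comment> \<open>Jensen's inequality for the exponential supplies the lower bound on
        \<open>L\<close> that the absorption in the lower tail uses.\<close>
      have "exp (P.expectation (\<lambda>w. t * - Z w)) \<le> P.expectation (\<lambda>w. exp (t * - Z w))"
        using iZ iexp[of "- t"]
        by (intro P.jensens_inequality[where I=UNIV]) (auto intro: exp_convex)
      then have "ln (exp (- (t * E))) \<le> L"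
        unfolding L_def by (subst ln_le_cancel_iff) (auto simp: E_def intro: less_le_trans[OF exp_gt_zero])
      then show ?thesis by simp
    qed
    ultimately have "L + t * ((1 - \<epsilon>) * E) \<le> 4.7\<^sup>2 * (t\<^sup>2 * v)"
      by (intro lower_exponent_le[OF t(1) E0 v0 \<epsilon> tb t(3)])
        (simp_all add: E_def[symmetric] algebra_simps power2_eq_square)
    then have "ln (\<integral>w. exp (t * (- 1 * Z w + (1 - \<epsilon>) * E)) \<partial>PiM I M) \<le> l / 4"
      unfolding shift using t(4) by (simp add: L_def)
    from P.nn_integral_pos_pow_le[OF t(1) l iexp' this t(2)] show ?thesis
      by (simp add: t(5))
  qed
qed

end

section \<open>Truncation of unbounded summands\<close>

text \<open>The point 0 is handled separately, by \<open>u powr l \<le> u\<close> for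
  \<open>u\<close> in [0, 1]. It has to be included because the truncation remainder vanishes
  wherever the envelope is small.\<close>

lemma convex_on_powr_nonneg:
  fixes l :: real
  assumes l: "1 \<le> l"
  shows "convex_on {0..} (\<lambda>x. x powr l)"
proof -
  have zero: "(u * y) powr l \<le> u * y powr l" if "0 \<le> u" "u \<le> 1" "0 \<le> y" for u y :: real
  proof -
    have "u powr l \<le> u" using powr_le_one_le[of u l] that l by (cases "u = 0") auto
    then show ?thesis using that by (simp add: powr_mult mult_right_mono)
  qed
  have "(u * x + v * y) powr l \<le> u * x powr l + v * y powr l"
    if "0 \<le> x" "0 \<le> y" "0 \<le> u" "0 \<le> v" "u + v = 1" for x y u v :: real
  proof (cases "x = 0 \<or> y = 0")
    case True
    then show ?thesis using zero[of v y] zero[of u x] that l by auto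
  next
    case False
    then show ?thesis
      using powr_convex[OF l] that unfolding convex_on_def by auto
  qed
  then show ?thesis unfolding convex_on_def by auto
qed

text \<open>Minkowski's inequality in terms of bounds on the norms: \<open>(U + V) / (A + B)\<close>
  is the convex combination of \<open>U / A\<close> and \<open>V / B\<close> with weights
  \<open>A / (A + B)\<close> and \<open>B / (A + B)\<close>. Convexity of the power then gives a
  pointwise estimate that only has to be integrated.\<close>

lemma nn_integral_powr_add_le:
  fixes U V :: "'a \<Rightarrow> real" and A B l :: real
  assumes l: "1 \<le> l" and A: "0 < A" and B: "0 < B"
    and U[measurable]: "U \<in> borel_measurable \<mu>" and V[measurable]: "V \<in> borel_measurable \<mu>"
    and U0: "\<And>x. x \<in> space \<mu> \<Longrightarrow> 0 \<le> U x" and V0: "\<And>x. x \<in> space \<mu> \<Longrightarrow> 0 \<le> V x"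
    and UA: "(\<integral>\<^sup>+x. ennreal (U x powr l) \<partial>\<mu>) \<le> ennreal (A powr l)"
    and VB: "(\<integral>\<^sup>+x. ennreal (V x powr l) \<partial>\<mu>) \<le> ennreal (B powr l)"
  shows "(\<integral>\<^sup>+x. ennreal ((U x + V x) powr l) \<partial>\<mu>) \<le> ennreal ((A + B) powr l)"
proof -
  define c where "c = (A + B) powr l * (A / (A + B)) / A powr l"
  define d where "d = (A + B) powr l * (B / (A + B)) / B powr l"
  have c0: "0 \<le> c" "0 \<le> d" using A B by (auto simp: c_def d_def)
  have sum: "c * A powr l + d * B powr l = (A + B) powr l"
  proof -
    have "c * A powr l = (A + B) powr l * (A / (A + B))" "d * B powr l = (A + B) powr l * (B / (A + B))"
      using A B by (simp_all add: c_def d_def)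
    then have "c * A powr l + d * B powr l = (A + B) powr l * (A / (A + B) + B / (A + B))"
      by (simp only: distrib_left)
    also have "A / (A + B) + B / (A + B) = 1" using A B by (simp add: add_divide_distrib[symmetric])
    finally show ?thesis by simp
  qed
  have pt: "(U x + V x) powr l \<le> c * U x powr l + d * V x powr l" if x: "x \<in> space \<mu>" for x
  proof -
    have "(A / (A + B)) * (U x / A) + (B / (A + B)) * (V x / B) = (U x + V x) / (A + B)"
      using A B by (simp add: add_divide_distrib)
    moreover have "A / (A + B) + B / (A + B) = 1" using A B by (simp add: add_divide_distrib[symmetric])
    ultimately have "((U x + V x) / (A + B)) powr l
        \<le> A / (A + B) * (U x / A) powr l + B / (A + B) * (V x / B) powr l"
      using convex_on_powr_nonneg[OF l] A B U0[OF x] V0[OF x] unfolding convex_on_def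
      by (metis atLeast_iff divide_nonneg_pos less_imp_le add_pos_pos real_scaleR_def)
    then have "(A + B) powr l * ((U x + V x) / (A + B)) powr l
        \<le> (A + B) powr l * (A / (A + B) * (U x / A) powr l + B / (A + B) * (V x / B) powr l)"
      by (intro mult_left_mono) auto
    also have "\<dots> = c * U x powr l + d * V x powr l"
      using A B U0[OF x] V0[OF x] by (simp add: c_def d_def powr_divide algebra_simps)
    also have "(A + B) powr l * ((U x + V x) / (A + B)) powr l = (U x + V x) powr l"
      using A B U0[OF x] V0[OF x] by (simp add: powr_divide)
    finally show ?thesis .
  qed
  have "(\<integral>\<^sup>+x. ennreal ((U x + V x) powr l) \<partial>\<mu>)
      \<le> (\<integral>\<^sup>+x. ennreal c * ennreal (U x powr l) + ennreal d * ennreal (V x powr l) \<partial>\<mu>)"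
    using pt c0 by (intro nn_integral_mono) (simp add: ennreal_mult[symmetric] ennreal_plus[symmetric] del: ennreal_plus)
  also have "\<dots> = ennreal c * (\<integral>\<^sup>+x. ennreal (U x powr l) \<partial>\<mu>) + ennreal d * (\<integral>\<^sup>+x. ennreal (V x powr l) \<partial>\<mu>)"
    by (simp add: nn_integral_add nn_integral_cmult)
  also have "\<dots> \<le> ennreal c * ennreal (A powr l) + ennreal d * ennreal (B powr l)"
    by (intro add_mono mult_left_mono UA VB) auto
  also have "\<dots> = ennreal ((A + B) powr l)"
    using c0 by (simp add: ennreal_mult[symmetric] ennreal_plus[symmetric] sum del: ennreal_plus)
  finally show ?thesis .
qed

text \<open>On a probability space the constant \<open>c\<close> has l-norm \<open>c\<close> and is
  a third summand for Minkowski's inequality. The case \<open>c = 0\<close> is split off because the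
  bounds there are strictly positive; it occurs for the lower tail at
  \<open>\<epsilon> = 1\<close>.\<close>

lemma (in prob_space) nn_integral_powr_add_add_const_le:
  fixes U V :: "'a \<Rightarrow> real" and A B l c :: real
  assumes l: "1 \<le> l" and A: "0 < A" and B: "0 < B" and c: "0 \<le> c"
    and U[measurable]: "U \<in> borel_measurable M" and V[measurable]: "V \<in> borel_measurable M"
    and U0: "\<And>x. x \<in> space M \<Longrightarrow> 0 \<le> U x" and V0: "\<And>x. x \<in> space M \<Longrightarrow> 0 \<le> V x"
    and UA: "(\<integral>\<^sup>+x. ennreal (U x powr l) \<partial>M) \<le> ennreal (A powr l)"
    and VB: "(\<integral>\<^sup>+x. ennreal (V x powr l) \<partial>M) \<le> ennreal (B powr l)"
  shows "(\<integral>\<^sup>+x. ennreal ((U x + V x + c) powr l) \<partial>M) \<le> ennreal ((A + B + c) powr l)"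
proof (cases "c = 0")
  case True
  then show ?thesis using nn_integral_powr_add_le[OF l A B U V U0 V0 UA VB] by simp
next
  case False
  show ?thesis
  proof (rule nn_integral_powr_add_le[OF l])
    show "(\<integral>\<^sup>+x. ennreal ((U x + V x) powr l) \<partial>M) \<le> ennreal ((A + B) powr l)"
      using nn_integral_powr_add_le[OF l A B U V U0 V0 UA VB] .
  qed (use A B c False U0 V0 in \<open>auto simp: emeasure_space_1\<close>)
qed

text \<open>Where \<open>e\<close> exceeds \<open>K\<close>, the factor
  \<open>e powr (k - p)\<close> has a nonpositive exponent and decreases in \<open>e\<close>. The
  lemma serves \<open>k = l\<close> for the moment of the remainder and \<open>k = 1\<close> for its
  mean.\<close>

lemma truncation_powr_le:
  fixes K k p e :: real
  assumes "0 < K" "1 \<le> k" "k \<le> p"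
  shows "(if e \<le> K then 0 else e) powr k \<le> K powr (k - p) * \<bar>e\<bar> powr p"
proof (cases "e \<le> K")
  case False
  then have e: "0 < e" "K \<le> e" using assms by auto
  have "e powr k = e powr (k - p) * e powr p" using e by (simp add: powr_add[symmetric])
  also have "\<dots> \<le> K powr (k - p) * e powr p"
    using assms e by (intro mult_right_mono powr_mono2') auto
  finally show ?thesis using False e by simp
qed simp

section \<open>Integrals of functions of a single coordinate\<close>

context product_prob_space
begin

lemma nn_integral_component:
  assumes "i \<in> I" "f \<in> borel_measurable (M i)"
  shows "(\<integral>\<^sup>+w. f (w i) \<partial>PiM I M) = (\<integral>\<^sup>+x. f x \<partial>M i)"
  using assms by (subst PiM_component[OF assms(1), symmetric], subst nn_integral_distr) auto

lemma integral_component: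
  fixes f :: "'a \<Rightarrow> real"
  assumes "i \<in> I" "f \<in> borel_measurable (M i)"
  shows "(\<integral>w. f (w i) \<partial>PiM I M) = (\<integral>x. f x \<partial>M i)"
  using assms by (subst PiM_component[OF assms(1), symmetric], subst integral_distr) auto

lemma integrable_component:
  fixes f :: "'a \<Rightarrow> real"
  assumes "i \<in> I" "integrable (M i) f"
  shows "integrable (PiM I M) (\<lambda>w. f (w i))"
  using assms by (intro integrable_distr[of "\<lambda>w. w i" _ "M i"]) (auto simp: PiM_component)

end

text \<open>The indices \<open>2 * j\<close> and \<open>2 * j + 1\<close> stand for the two signs of
  \<open>a j\<close>. Since \<open>j\<close> starts at 1, the range starts at 2 and ends at
  \<open>2 * N + 1\<close>.\<close>

lemma Max_signed_eq_Max_abs: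
  fixes a :: "nat \<Rightarrow> real"
  assumes N: "1 \<le> N"
  shows "Max ((\<lambda>s. (if even s then 1 else -1) * a (s div 2)) ` {2..2 * N + 1}) = Max ((\<lambda>j. \<bar>a j\<bar>) ` {1..N})"
proof (rule antisym)
  show "Max ((\<lambda>s. (if even s then 1 else -1) * a (s div 2)) ` {2..2 * N + 1}) \<le> Max ((\<lambda>j. \<bar>a j\<bar>) ` {1..N})"
  proof (rule Max.boundedI)
    fix x assume "x \<in> (\<lambda>s. (if even s then 1 else -1) * a (s div 2)) ` {2..2 * N + 1}"
    then obtain s where s: "2 \<le> s" "s \<le> 2 * N + 1" "x = (if even s then 1 else -1) * a (s div 2)" by auto
    have "x \<le> \<bar>a (s div 2)\<bar>" by (auto simp: s(3))
    also have "s div 2 \<in> {1..N}" using s(1,2) by auto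
    then have "\<bar>a (s div 2)\<bar> \<le> Max ((\<lambda>j. \<bar>a j\<bar>) ` {1..N})" by (intro Max_ge imageI) auto
    finally show "x \<le> Max ((\<lambda>j. \<bar>a j\<bar>) ` {1..N})" .
  qed (use N in auto)
  show "Max ((\<lambda>j. \<bar>a j\<bar>) ` {1..N}) \<le> Max ((\<lambda>s. (if even s then 1 else -1) * a (s div 2)) ` {2..2 * N + 1})"
  proof (rule Max.boundedI)
    fix x assume "x \<in> (\<lambda>j. \<bar>a j\<bar>) ` {1..N}"
    then obtain j where j: "1 \<le> j" "j \<le> N" "x = \<bar>a j\<bar>" by auto
    define s where "s = (if 0 \<le> a j then 2 * j else 2 * j + 1)"
    have "x = (if even s then 1 else -1) * a (s div 2)" by (auto simp: s_def j(3))
    then show "x \<le> Max ((\<lambda>s. (if even s then 1 else -1) * a (s div 2)) ` {2..2 * N + 1})"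
      using j by (intro Max_ge) (auto simp: s_def intro!: imageI)
  qed (use N in auto)
qed

lemma Max_abs_diff_le:
  fixes a a' :: "nat \<Rightarrow> real"
  assumes S: "finite S" "S \<noteq> {}" and d: "\<And>j. j \<in> S \<Longrightarrow> \<bar>a j - a' j\<bar> \<le> r"
  shows "\<bar>Max ((\<lambda>j. \<bar>a j\<bar>) ` S) - Max ((\<lambda>j. \<bar>a' j\<bar>) ` S)\<bar> \<le> r"
proof -
  have *: "Max ((\<lambda>j. \<bar>a j\<bar>) ` S) \<le> Max ((\<lambda>j. \<bar>a' j\<bar>) ` S) + r"
    if d: "\<And>j. j \<in> S \<Longrightarrow> \<bar>a j - a' j\<bar> \<le> r" for a a' :: "nat \<Rightarrow> real"
  proof (rule Max.boundedI)
    fix x assume "x \<in> (\<lambda>j. \<bar>a j\<bar>) ` S"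
    then obtain j where j: "j \<in> S" "x = \<bar>a j\<bar>" by auto
    have "\<bar>a' j\<bar> \<le> Max ((\<lambda>j. \<bar>a' j\<bar>) ` S)" using S j by (intro Max_ge) auto
    then show "x \<le> Max ((\<lambda>j. \<bar>a' j\<bar>) ` S) + r" using d[OF j(1)] j(2) by linarith
  qed (use S in auto)
  have "\<bar>a' j - a j\<bar> \<le> r" if "j \<in> S" for j using d[OF that] by linarith
  from *[of a a', OF d] *[of a' a, OF this] show ?thesis by linarith
qed

text \<open>The original and the truncated maximum differ by at most \<open>R\<close>, and their
  means by at most \<open>b\<close>. Hence each positive part is at most that of the truncated
  maximum plus \<open>R\<close> plus \<open>(1 + \<epsilon>) * b\<close> or
  \<open>(1 - \<epsilon>) * b\<close>, three summands for Minkowski's inequality. As in the locale,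
  every index carries a probability space.\<close>

lemma Zmax_concentration:
  fixes M :: "nat \<Rightarrow> 'a measure"
    and Zf :: "nat \<Rightarrow> nat \<Rightarrow> 'a \<Rightarrow> real"
    and Env :: "nat \<Rightarrow> 'a \<Rightarrow> real"
    and n N :: nat and p Mb l \<epsilon> :: real
  defines "P \<equiv> PiM {1..n} M"
  defines "E \<equiv> (\<integral>w. Zmax Zf n N w \<partial>P)"
  defines "r \<equiv> l * Mb / real n powr (1 - l / p)"
  defines "\<sigma> \<equiv> sqrt (enn2real (sigma_sq M Zf n N))"
  assumes n_pos: "n \<ge> 1" and N_pos: "N \<ge> 1"
    and prob: "\<And>i. prob_space (M i)"
    and meas: "\<And>i j. i \<in> {1..n} \<Longrightarrow> j \<in> {1..N} \<Longrightarrow> Zf i j \<in> borel_measurable (M i)"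
    and env_meas: "\<And>i. i \<in> {1..n} \<Longrightarrow> Env i \<in> borel_measurable (M i)"
    and env: "\<And>i j x. i \<in> {1..n} \<Longrightarrow> j \<in> {1..N} \<Longrightarrow> x \<in> space (M i) \<Longrightarrow> \<bar>Zf i j x\<bar> \<le> Env i x"
    and p: "1 \<le> p" and Mb: "Mb > 0"
    and mom: "\<And>i. i \<in> {1..n} \<Longrightarrow>
       (\<integral>\<^sup>+ x. ennreal (\<bar>Env i x\<bar> powr p) \<partial>(M i)) \<le> ennreal (Mb powr p)"
    and l: "1 \<le> l" "l \<le> p"
    and sig_fin: "sigma_sq M Zf n N < \<infinity>"
    and \<epsilon>: "0 < \<epsilon>"
  shows "(\<integral>\<^sup>+ w. ennreal (pos_pow (Zmax Zf n N w - (1 + \<epsilon>) * E) l) \<partial>P)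
      \<le> ennreal (((64 / \<epsilon> + 7 + \<epsilon>) * r + 4 * sqrt l * \<sigma> / sqrt (real n)) powr l)"
    and "\<epsilon> \<le> 1 \<Longrightarrow> (\<integral>\<^sup>+ w. ennreal (pos_pow ((1 - \<epsilon>) * E - Zmax Zf n N w) l) \<partial>P)
      \<le> ennreal (((86.4 / \<epsilon> + 7 - \<epsilon>) * r + 4.7 * sqrt l * \<sigma> / sqrt (real n)) powr l)"
proof -
  interpret product_prob_space M "{1..n}"
    using prob by (intro product_prob_spaceI)
  interpret Q: prob_space P unfolding P_def by (rule prob_space_PiM) (rule prob)
  have n0: "0 < real n" using n_pos by simp
  have p0: "0 < p" using p by simp
  \<comment> \<open>The level balances two errors: truncated summands divided by \<open>n\<close>
    are bounded by \<open>K / n = Mb * n powr (l / p - 1)\<close>, and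
    \<open>K powr (l - p) * Mb powr p\<close>, the bound for the l-th moment of a remainder, is
    exactly \<open>(K / n) powr l\<close>.\<close>
  define K where "K = Mb * real n powr (l / p)"
  define b where "b = K / real n"
  have K0: "0 < K" and b0: "0 < b" using Mb n0 by (auto simp: K_def b_def)
  have b_eq: "b = Mb * real n powr (l / p - 1)" using n0 by (simp add: b_def K_def powr_diff)
  have lb: "l * b = r" using n0 by (simp add: r_def b_eq powr_diff field_simps)
  have K_powr: "K powr (k - p) * Mb powr p = Mb powr k * real n powr (l / p * (k - p))" for k
    using Mb n0 by (simp add: K_def powr_mult powr_powr) (simp add: powr_add[symmetric])
  \<comment> \<open>The cut is made where the envelope is large, not where \<open>Zf i j\<close> is,
    so the event is common to all \<open>j\<close> and one remainder \<open>rem\<close> serves the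
    whole maximum.\<close>
  define tr where "tr i j x = (if Env i x \<le> K then Zf i j x else 0)" for i j x
  define rem where "rem i x = (if Env i x \<le> K then 0 else Env i x)" for i x
  have tr_m[measurable]: "tr i j \<in> borel_measurable (M i)" if "i \<in> {1..n}" "j \<in> {1..N}" for i j
    using meas[OF that] env_meas[OF that(1)] unfolding tr_def[abs_def] by measurable
  have rem_m[measurable]: "rem i \<in> borel_measurable (M i)" if "i \<in> {1..n}" for i
    using env_meas[OF that] unfolding rem_def[abs_def] by measurable
  have rem0: "0 \<le> rem i x" for i x using K0 by (simp add: rem_def)
  have tr_K: "\<bar>tr i j x\<bar> \<le> K" if "i \<in> {1..n}" "j \<in> {1..N}" "x \<in> space (M i)" for i j x
    using env[OF that] K0 by (auto simp: tr_def)
  have tr_rem: "\<bar>Zf i j x - tr i j x\<bar> \<le> rem i x" if "i \<in> {1..n}" "j \<in> {1..N}" "x \<in> space (M i)" for i j x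
    using env[OF that] by (auto simp: tr_def rem_def)
  define R where "R w = (1 / real n) * (\<Sum>i\<in>{1..n}. rem i (w i))" for w
  have comp: "w i \<in> space (M i)" if "w \<in> space P" "i \<in> {1..n}" for w i
    using that by (auto simp: P_def space_PiM)
  have comp_m: "(\<lambda>w. f (w i)) \<in> borel_measurable P" if "i \<in> {1..n}" "f \<in> borel_measurable (M i)" for f :: "'a \<Rightarrow> real" and i
    unfolding P_def by (rule measurable_compose[OF measurable_component_singleton[of _ _ M, OF that(1)] that(2)])
  have Pn_m: "PnZ f n j \<in> borel_measurable P" if "\<And>i. i \<in> {1..n} \<Longrightarrow> f i j \<in> borel_measurable (M i)" for f j
    unfolding PnZ_def[abs_def] using that by (intro borel_measurable_times borel_measurable_const borel_measurable_sum comp_m) auto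
  have R_m[measurable]: "R \<in> borel_measurable P"
    unfolding R_def[abs_def] by (intro borel_measurable_times borel_measurable_const borel_measurable_sum comp_m rem_m) auto
  have Z_m[measurable]: "Zmax Zf n N \<in> borel_measurable P"
    unfolding Zmax_def[abs_def] by (intro borel_measurable_Max borel_measurable_abs Pn_m meas) auto
  have Zt_m[measurable]: "Zmax tr n N \<in> borel_measurable P"
    unfolding Zmax_def[abs_def] by (intro borel_measurable_Max borel_measurable_abs Pn_m tr_m) auto
  have R0: "0 \<le> R w" for w unfolding R_def using n0 by (intro mult_nonneg_nonneg sum_nonneg rem0) auto
  have ZR: "\<bar>Zmax Zf n N w - Zmax tr n N w\<bar> \<le> R w" if w: "w \<in> space P" for w
    unfolding Zmax_def
  proof (rule Max_abs_diff_le)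
    fix j assume j: "j \<in> {1..N}"
    have "PnZ Zf n j w - PnZ tr n j w = (1 / real n) * (\<Sum>i\<in>{1..n}. Zf i j (w i) - tr i j (w i))"
      by (simp add: PnZ_def sum_subtractf right_diff_distrib)
    then have "\<bar>PnZ Zf n j w - PnZ tr n j w\<bar> = (1 / real n) * \<bar>\<Sum>i\<in>{1..n}. Zf i j (w i) - tr i j (w i)\<bar>"
      using n0 by (simp add: abs_mult)
    also have "\<dots> \<le> (1 / real n) * (\<Sum>i\<in>{1..n}. rem i (w i))"
      using n0 j comp[OF w] by (intro mult_left_mono order_trans[OF sum_abs] sum_mono tr_rem) auto
    finally show "\<bar>PnZ Zf n j w - PnZ tr n j w\<bar> \<le> R w" by (simp add: R_def)
  qed (use N_pos in auto)
  have rem_mom: "(\<integral>\<^sup>+x. ennreal (rem i x powr k) \<partial>M i) \<le> ennreal (Mb powr k * real n powr (l / p * (k - p)))"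
    if i: "i \<in> {1..n}" and k: "1 \<le> k" "k \<le> p" for i k
  proof -
    have "(\<integral>\<^sup>+x. ennreal (rem i x powr k) \<partial>M i) \<le> (\<integral>\<^sup>+x. ennreal (K powr (k - p)) * ennreal (\<bar>Env i x\<bar> powr p) \<partial>M i)"
      using truncation_powr_le[OF K0 k] unfolding rem_def
      by (intro nn_integral_mono) (simp add: ennreal_mult[symmetric] ennreal_leI)
    also have "\<dots> = ennreal (K powr (k - p)) * (\<integral>\<^sup>+x. ennreal (\<bar>Env i x\<bar> powr p) \<partial>M i)"
      using env_meas[OF i] by (intro nn_integral_cmult) measurable
    also have "\<dots> \<le> ennreal (K powr (k - p)) * ennreal (Mb powr p)"
      by (intro mult_left_mono mom[OF i]) auto
    also have "\<dots> = ennreal (Mb powr k * real n powr (l / p * (k - p)))"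
      by (simp add: ennreal_mult[symmetric] K_powr)
    finally show ?thesis .
  qed
  have R_mom: "(\<integral>\<^sup>+w. ennreal (R w powr l) \<partial>P) \<le> ennreal (b powr l)"
  proof -
    have "R w powr l \<le> (\<Sum>i\<in>{1..n}. (1 / real n) * rem i (w i) powr l)" for w
      using convex_on_sum[of "{1..n}" "{0..}" "\<lambda>x. x powr l" "\<lambda>_. 1 / real n" "\<lambda>i. rem i (w i)"]
        convex_on_powr_nonneg[OF l(1)] n_pos rem0
      by (simp add: R_def sum_distrib_left)
    then have "(\<integral>\<^sup>+w. ennreal (R w powr l) \<partial>P) \<le> (\<integral>\<^sup>+w. (\<Sum>i\<in>{1..n}. ennreal (1 / real n) * ennreal (rem i (w i) powr l)) \<partial>P)"
      by (intro nn_integral_mono) (simp add: ennreal_mult[symmetric] sum_ennreal ennreal_leI)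
    also have "\<dots> = (\<Sum>i\<in>{1..n}. ennreal (1 / real n) * (\<integral>\<^sup>+w. ennreal (rem i (w i) powr l) \<partial>P))"
      using comp_m[OF _ rem_m] by (subst nn_integral_sum) (auto intro!: sum.cong nn_integral_cmult)
    also have "\<dots> = (\<Sum>i\<in>{1..n}. ennreal (1 / real n) * (\<integral>\<^sup>+x. ennreal (rem i x powr l) \<partial>M i))"
      unfolding P_def by (intro sum.cong refl arg_cong2[where f="(*)"] nn_integral_component) auto
    also have "\<dots> \<le> (\<Sum>i\<in>{1..n}. ennreal (1 / real n) * ennreal (Mb powr l * real n powr (l / p * (l - p))))"
      using l by (intro sum_mono mult_left_mono rem_mom) auto
    also have "\<dots> = ennreal (Mb powr l * real n powr (l / p * (l - p)))"
      using n0 by (simp add: ennreal_mult[symmetric] ennreal_of_nat_eq_real_of_nat)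
    also have "Mb powr l * real n powr (l / p * (l - p)) = b powr l"
      using Mb n0 p0 by (simp add: b_eq powr_mult powr_powr field_simps)
    finally show ?thesis .
  qed
  have rem_i: "integrable (M i) (rem i)" "(\<integral>x. rem i x \<partial>M i) \<le> b" if i: "i \<in> {1..n}" for i
  proof -
    have "(\<integral>\<^sup>+x. ennreal (rem i x) \<partial>M i) \<le> ennreal (Mb powr 1 * real n powr (l / p * (1 - p)))"
      using rem_mom[OF i, of 1] p rem0 by simp
    also have "\<dots> \<le> ennreal b"
    proof (rule ennreal_leI)
      \<comment> \<open>The left exponent is \<open>l / p - l\<close>, so this is
        \<open>1 \<le> l\<close>; with \<open>n \<ge> 1\<close> the mean of the remainder obeys the
        same bound \<open>b\<close> as its l-norm.\<close>
      have "l / p * (1 - p) \<le> l / p - 1" using l p0 by (simp add: field_simps)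
      then show "Mb powr 1 * real n powr (l / p * (1 - p)) \<le> b"
        using Mb n_pos unfolding b_eq by (auto intro!: powr_mono)
    qed
    finally have le: "(\<integral>\<^sup>+x. ennreal (rem i x) \<partial>M i) \<le> ennreal b" .
    show int: "integrable (M i) (rem i)"
      using le rem0 rem_m[OF i] by (intro integrableI_nonneg) (auto intro: le_less_trans)
    show "(\<integral>x. rem i x \<partial>M i) \<le> b"
      using le rem0 b0 int by (subst (asm) nn_integral_eq_integral) auto
  qed
  have R_i: "integrable P R" "(\<integral>w. R w \<partial>P) \<le> b"
  proof -
    have i: "integrable P (\<lambda>w. rem i (w i))" if "i \<in> {1..n}" for i
      unfolding P_def using that by (intro integrable_component rem_i) auto
    then show "integrable P R" unfolding R_def[abs_def] by (intro integrable_mult_right Bochner_Integration.integrable_sum) auto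
    have "(\<integral>w. R w \<partial>P) = (1 / real n) * (\<Sum>i\<in>{1..n}. \<integral>w. rem i (w i) \<partial>P)"
      unfolding R_def using i by (simp add: Bochner_Integration.integral_sum)
    also have "\<dots> = (1 / real n) * (\<Sum>i\<in>{1..n}. \<integral>x. rem i x \<partial>M i)"
      unfolding P_def by (intro arg_cong2[where f="(*)"] refl sum.cong integral_component rem_m) auto
    also have "\<dots> \<le> (1 / real n) * (\<Sum>i\<in>{1..n}. b)"
      using n0 by (intro mult_left_mono sum_mono rem_i) auto
    finally show "(\<integral>w. R w \<partial>P) \<le> b" using n0 by simp
  qed
  \<comment> \<open>The index \<open>s\<close> encodes the pair of \<open>j = s div 2\<close> and a sign, so that the maximum of absolute values becomes a plain maximum.\<close>
  define g where "g i s x = (if even s then 1 else -1) * tr i (s div 2) x / real n" for i s x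
  define S where "S = {2..2 * N + 1}"
  have S: "finite S" "S \<noteq> {}" using N_pos by (auto simp: S_def)
  have Sdiv: "s div 2 \<in> {1..N}" if "s \<in> S" for s using that by (auto simp: S_def)
  have sum_g: "(\<Sum>i\<in>{1..n}. g i s (w i)) = (if even s then 1 else -1) * PnZ tr n (s div 2) w" for s w
    by (simp add: g_def PnZ_def sum_divide_distrib[symmetric] sum_distrib_left[symmetric] sum_negf)
  have Zt_eq: "Max ((\<lambda>s. \<Sum>i\<in>{1..n}. g i s (w i)) ` S) = Zmax tr n N w" for w
    unfolding sum_g S_def Zmax_def using N_pos by (rule Max_signed_eq_Max_abs)
  define E' where "E' = (\<integral>w. Zmax tr n N w \<partial>P)"
  have Zt_ge: "\<bar>PnZ tr n j w\<bar> \<le> Zmax tr n N w" if "j \<in> {1..N}" for j w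
    unfolding Zmax_def using that by (intro Max_ge) auto
  have Zt_le: "Zmax tr n N w \<le> K" if w: "w \<in> space P" for w
    unfolding Zmax_def
  proof (rule Max.boundedI)
    fix x assume "x \<in> (\<lambda>j. \<bar>PnZ tr n j w\<bar>) ` {1..N}"
    then obtain j where j: "j \<in> {1..N}" "x = \<bar>PnZ tr n j w\<bar>" by auto
    have "x = (1 / real n) * \<bar>\<Sum>i\<in>{1..n}. tr i j (w i)\<bar>" using n0 by (simp add: j(2) PnZ_def abs_mult)
    also have "\<dots> \<le> (1 / real n) * (\<Sum>i\<in>{1..n}. K)"
      using n0 j comp[OF w] by (intro mult_left_mono order_trans[OF sum_abs] sum_mono tr_K) auto
    finally show "x \<le> K" using n0 by simp
  qed (use N_pos in auto)
  have Zt0: "0 \<le> Zmax tr n N w" for w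
    using Zt_ge[of 1 w] N_pos by (intro order_trans[OF abs_ge_zero]) auto
  have Zt_i: "integrable P (Zmax tr n N)"
    using Zt_le Zt0 by (intro Q.integrable_bounded[where B=K]) auto
  have E'0: "0 \<le> E'" unfolding E'_def using Zt0 by (intro integral_nonneg_AE) auto
  have Z_i: "integrable P (Zmax Zf n N)"
  proof (rule Bochner_Integration.integrable_bound[OF Bochner_Integration.integrable_add[OF Zt_i R_i(1)]])
    show "AE w in P. norm (Zmax Zf n N w) \<le> norm (Zmax tr n N w + R w)"
    proof (rule AE_I2)
      fix w assume "w \<in> space P"
      from ZR[OF this] Zt0[of w] R0[of w]
      show "norm (Zmax Zf n N w) \<le> norm (Zmax tr n N w + R w)" by simp
    qed
  qed simp
  have EE': "\<bar>E - E'\<bar> \<le> b"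
  proof -
    have "Zmax Zf n N w \<le> Zmax tr n N w + R w" "Zmax tr n N w \<le> Zmax Zf n N w + R w"
      if "w \<in> space P" for w using ZR[OF that] by linarith+
    then have "E \<le> (\<integral>w. Zmax tr n N w + R w \<partial>P)" "E' \<le> (\<integral>w. Zmax Zf n N w + R w \<partial>P)"
      unfolding E_def E'_def using Z_i Zt_i R_i(1) by (intro integral_mono; simp)+
    then have "E \<le> E' + (\<integral>w. R w \<partial>P)" "E' \<le> E + (\<integral>w. R w \<partial>P)"
      using Z_i Zt_i R_i(1) by (simp_all add: E_def E'_def)
    then show ?thesis using R_i(2) by linarith
  qed
  \<comment> \<open>The division by \<open>n\<close> accounts for the factor \<open>1 / n\<close>
    inside \<open>g\<close>: squaring it leaves one \<open>1 / n\<close> more than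
    \<open>sigma_sq\<close> contains.\<close>
  define v where "v = enn2real (sigma_sq M Zf n N) / real n"
  have sqv: "sqrt v = \<sigma> / sqrt (real n)" by (simp add: v_def \<sigma>_def real_sqrt_divide)
  have g_m: "g i s \<in> borel_measurable (M i)" if "i \<in> {1..n}" "s \<in> S" for i s
    using tr_m[OF that(1) Sdiv[OF that(2)]] unfolding g_def[abs_def] by measurable
  have g_b: "\<bar>g i s x\<bar> \<le> b" if "i \<in> {1..n}" "s \<in> S" "x \<in> space (M i)" for i s x
    using tr_K[OF that(1) Sdiv[OF that(2)] that(3)] n0
    by (auto simp: g_def b_def abs_mult divide_right_mono)
  have var: "(\<Sum>i\<in>{1..n}. \<integral>x. (g i s x)\<^sup>2 \<partial>M i) \<le> v" if s: "s \<in> S" for s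
  proof -
    define j where "j = s div 2"
    have j: "j \<in> {1..N}" using Sdiv[OF s] by (simp add: j_def)
    \<comment> \<open>Truncation to 0 can only decrease an uncentred second moment.\<close>
    have tr2: "ennreal (\<integral>x. (tr i j x)\<^sup>2 \<partial>M i) \<le> (\<integral>\<^sup>+x. ennreal ((Zf i j x)\<^sup>2) \<partial>M i)" if i: "i \<in> {1..n}" for i
    proof -
      have "integrable (M i) (\<lambda>x. (tr i j x)\<^sup>2)"
        using tr_K[OF i j] tr_m[OF i j] K0
        by (intro M.integrable_bounded[where B="K\<^sup>2"]) (auto intro!: power2_le_iff_abs_le[THEN iffD2])
      then have "ennreal (\<integral>x. (tr i j x)\<^sup>2 \<partial>M i) = (\<integral>\<^sup>+x. ennreal ((tr i j x)\<^sup>2) \<partial>M i)"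
        by (intro nn_integral_eq_integral[symmetric]) auto
      also have "\<dots> \<le> (\<integral>\<^sup>+x. ennreal ((Zf i j x)\<^sup>2) \<partial>M i)"
        by (intro nn_integral_mono ennreal_leI) (auto simp: tr_def)
      finally show ?thesis .
    qed
    have "ennreal ((1 / real n) * (\<Sum>i\<in>{1..n}. \<integral>x. (tr i j x)\<^sup>2 \<partial>M i))
       = ennreal (1 / real n) * (\<Sum>i\<in>{1..n}. ennreal (\<integral>x. (tr i j x)\<^sup>2 \<partial>M i))"
      using n0 by (subst ennreal_mult) (auto intro!: sum_nonneg simp: sum_ennreal)
    also have "\<dots> \<le> ennreal (1 / real n) * (\<Sum>i\<in>{1..n}. \<integral>\<^sup>+x. ennreal ((Zf i j x)\<^sup>2) \<partial>M i)"
      by (intro mult_left_mono sum_mono tr2) auto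
    also have "\<dots> \<le> sigma_sq M Zf n N"
      unfolding sigma_sq_def using j by (intro Max_ge) auto
    \<comment> \<open>Finiteness of \<open>sigma_sq\<close> makes the conversion lossless;
      \<open>enn2real\<close> would send an infinite value to 0.\<close>
    also have "\<dots> = ennreal (enn2real (sigma_sq M Zf n N))"
      using sig_fin by simp
    finally have "(1 / real n) * (\<Sum>i\<in>{1..n}. \<integral>x. (tr i j x)\<^sup>2 \<partial>M i) \<le> enn2real (sigma_sq M Zf n N)"
      by (simp add: ennreal_le_iff)
    then have "(1 / real n) * (\<Sum>i\<in>{1..n}. \<integral>x. (tr i j x)\<^sup>2 \<partial>M i) / real n \<le> v"
      unfolding v_def using n0 by (intro divide_right_mono) auto
    moreover have "(\<integral>x. (g i s x)\<^sup>2 \<partial>M i) = (\<integral>x. (tr i j x)\<^sup>2 \<partial>M i) / real n / real n" for i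
      by (simp add: g_def j_def power_divide power2_eq_square)
    ultimately show ?thesis by (simp add: sum_divide_distrib)
  qed
  \<comment> \<open>Replacement for centring: minus a signed sum is at most its absolute value,
    hence at most the truncated maximum at every point, and this inequality survives taking
    expectations.\<close>
  have mean: "- (\<Sum>i\<in>{1..n}. \<integral>x. g i s x \<partial>M i) \<le> E'" if s: "s \<in> S" for s
  proof -
    have ig: "integrable P (\<lambda>w. g i s (w i))" if "i \<in> {1..n}" for i
      unfolding P_def using that s g_b g_m
      by (intro integrable_component M.integrable_bounded) auto
    have "(\<Sum>i\<in>{1..n}. \<integral>x. g i s x \<partial>M i) = (\<Sum>i\<in>{1..n}. \<integral>w. g i s (w i) \<partial>P)"
      unfolding P_def using s by (intro sum.cong refl integral_component[symmetric] g_m) auto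
    also have "\<dots> = (\<integral>w. (\<Sum>i\<in>{1..n}. g i s (w i)) \<partial>P)"
      using ig by (simp add: Bochner_Integration.integral_sum)
    finally have "- (\<Sum>i\<in>{1..n}. \<integral>x. g i s x \<partial>M i) = (\<integral>w. - (\<Sum>i\<in>{1..n}. g i s (w i)) \<partial>P)" by simp
    also have "\<dots> \<le> E'" unfolding E'_def
    proof (rule integral_mono)
      show "integrable P (\<lambda>w. - (\<Sum>i\<in>{1..n}. g i s (w i)))"
        by (intro integrable_minus Bochner_Integration.integrable_sum ig)
      show "- (\<Sum>i\<in>{1..n}. g i s (w i)) \<le> Zmax tr n N w" for w
        using Zt_ge[OF Sdiv[OF s], of w] unfolding sum_g by auto
    qed (rule Zt_i)
    finally show ?thesis .
  qed
  note bounded = bounded_Max_sum_concentration[where g=g and S=S and b=b and v=v and l=l and \<epsilon>=\<epsilon>,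
      unfolded Zt_eq, folded P_def E'_def, OF _ S b0 g_m g_b var mean E'0 l(1) \<epsilon>, simplified sqv]
  show "(\<integral>\<^sup>+ w. ennreal (pos_pow (Zmax Zf n N w - (1 + \<epsilon>) * E) l) \<partial>P)
      \<le> ennreal (((64 / \<epsilon> + 7 + \<epsilon>) * r + 4 * sqrt l * \<sigma> / sqrt (real n)) powr l)"
  proof -
    define A where "A = (64 / \<epsilon> + 5) * (l * b) + 4 * sqrt l * (\<sigma> / sqrt (real n))"
    have A0: "0 < A" unfolding A_def using \<epsilon> l b0 by (intro add_pos_nonneg mult_pos_pos) (auto simp: \<sigma>_def add_pos_pos)
    have "(\<integral>\<^sup>+ w. ennreal (pos_pow (Zmax Zf n N w - (1 + \<epsilon>) * E) l) \<partial>P)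
       \<le> (\<integral>\<^sup>+ w. ennreal ((max 0 (Zmax tr n N w - (1 + \<epsilon>) * E') + R w + (1 + \<epsilon>) * b) powr l) \<partial>P)"
    proof (intro nn_integral_mono ennreal_leI)
      fix w assume w: "w \<in> space P"
      have "(1 + \<epsilon>) * (E' - E) \<le> (1 + \<epsilon>) * b" using EE' \<epsilon> by (intro mult_left_mono) auto
      moreover have "Zmax Zf n N w \<le> Zmax tr n N w + R w" using ZR[OF w] by (simp add: abs_le_iff)
      moreover have "0 \<le> (1 + \<epsilon>) * b" using \<epsilon> b0 by simp
      ultimately have "max 0 (Zmax Zf n N w - (1 + \<epsilon>) * E)
         \<le> max 0 (Zmax tr n N w - (1 + \<epsilon>) * E') + R w + (1 + \<epsilon>) * b"
        using R0[of w] by (simp add: max_def algebra_simps)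
      then show "pos_pow (Zmax Zf n N w - (1 + \<epsilon>) * E) l
         \<le> (max 0 (Zmax tr n N w - (1 + \<epsilon>) * E') + R w + (1 + \<epsilon>) * b) powr l"
        unfolding pos_pow_def using l by (intro powr_mono2) auto
    qed
    also have "\<dots> \<le> ennreal ((A + b + (1 + \<epsilon>) * b) powr l)"
      using bounded(1) \<epsilon> R0 b0 unfolding pos_pow_def
      by (intro Q.nn_integral_powr_add_add_const_le[OF l(1) A0 b0] R_mom) (auto simp: A_def)
    also have "\<dots> \<le> ennreal (((64 / \<epsilon> + 7 + \<epsilon>) * r + 4 * sqrt l * \<sigma> / sqrt (real n)) powr l)"
    proof (intro ennreal_leI powr_mono2)
      \<comment> \<open>Origin of \<open>7 + \<epsilon>\<close>: 5 from the bounded part, 1 from the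
        remainder and \<open>1 + \<epsilon>\<close> from the shift of the mean, each
        \<open>b\<close> being enlarged to \<open>l * b = r\<close>.\<close>
      have "b + (1 + \<epsilon>) * b = (2 + \<epsilon>) * (1 * b)" by (simp add: algebra_simps)
      also have "\<dots> \<le> (2 + \<epsilon>) * (l * b)" using \<epsilon> l b0 by (intro mult_left_mono mult_right_mono) auto
      finally show "A + b + (1 + \<epsilon>) * b \<le> (64 / \<epsilon> + 7 + \<epsilon>) * r + 4 * sqrt l * \<sigma> / sqrt (real n)"
        unfolding lb[symmetric] A_def by (simp add: algebra_simps)
      show "0 \<le> A + b + (1 + \<epsilon>) * b" using A0 b0 \<epsilon> by simp
    qed (use l in auto)
    finally show ?thesis .
  qed
  show "(\<integral>\<^sup>+ w. ennreal (pos_pow ((1 - \<epsilon>) * E - Zmax Zf n N w) l) \<partial>P)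
      \<le> ennreal (((86.4 / \<epsilon> + 7 - \<epsilon>) * r + 4.7 * sqrt l * \<sigma> / sqrt (real n)) powr l)" if \<epsilon>1: "\<epsilon> \<le> 1"
  proof -
    define A where "A = (86.4 / \<epsilon> + 5) * (l * b) + 4.7 * sqrt l * (\<sigma> / sqrt (real n))"
    have A0: "0 < A" unfolding A_def using \<epsilon> l b0 by (intro add_pos_nonneg mult_pos_pos) (auto simp: \<sigma>_def add_pos_pos)
    have "(\<integral>\<^sup>+ w. ennreal (pos_pow ((1 - \<epsilon>) * E - Zmax Zf n N w) l) \<partial>P)
       \<le> (\<integral>\<^sup>+ w. ennreal ((max 0 ((1 - \<epsilon>) * E' - Zmax tr n N w) + R w + (1 - \<epsilon>) * b) powr l) \<partial>P)"
    proof (intro nn_integral_mono ennreal_leI)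
      fix w assume w: "w \<in> space P"
      have "(1 - \<epsilon>) * (E - E') \<le> (1 - \<epsilon>) * b" using EE' \<epsilon>1 by (intro mult_left_mono) auto
      moreover have "Zmax tr n N w \<le> Zmax Zf n N w + R w" using ZR[OF w] by (simp add: abs_le_iff)
      moreover have "0 \<le> (1 - \<epsilon>) * b" using \<epsilon>1 b0 by simp
      ultimately have "max 0 ((1 - \<epsilon>) * E - Zmax Zf n N w)
         \<le> max 0 ((1 - \<epsilon>) * E' - Zmax tr n N w) + R w + (1 - \<epsilon>) * b"
        using R0[of w] by (simp add: max_def algebra_simps)
      then show "pos_pow ((1 - \<epsilon>) * E - Zmax Zf n N w) l
         \<le> (max 0 ((1 - \<epsilon>) * E' - Zmax tr n N w) + R w + (1 - \<epsilon>) * b) powr l"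
        unfolding pos_pow_def using l by (intro powr_mono2) auto
    qed
    also have "\<dots> \<le> ennreal ((A + b + (1 - \<epsilon>) * b) powr l)"
      using bounded(2) \<epsilon>1 R0 b0 unfolding pos_pow_def
      by (intro Q.nn_integral_powr_add_add_const_le[OF l(1) A0 b0] R_mom) (auto simp: A_def)
    also have "\<dots> \<le> ennreal (((86.4 / \<epsilon> + 7 - \<epsilon>) * r + 4.7 * sqrt l * \<sigma> / sqrt (real n)) powr l)"
    proof (intro ennreal_leI powr_mono2)
      have "b + (1 - \<epsilon>) * b = (2 - \<epsilon>) * (1 * b)" by (simp add: algebra_simps)
      also have "\<dots> \<le> (2 - \<epsilon>) * (l * b)" using \<epsilon>1 l b0 by (intro mult_left_mono mult_right_mono) auto
      finally show "A + b + (1 - \<epsilon>) * b \<le> (86.4 / \<epsilon> + 7 - \<epsilon>) * r + 4.7 * sqrt l * \<sigma> / sqrt (real n)"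
        unfolding lb[symmetric] A_def by (simp add: algebra_simps)
      show "0 \<le> A + b + (1 - \<epsilon>) * b" using A0 b0 \<epsilon>1 by simp
    qed (use l in auto)
    finally show ?thesis .
  qed
qed

theorem theorem3p1:
  fixes M :: "nat \<Rightarrow> 'a measure"
    and Zf :: "nat \<Rightarrow> nat \<Rightarrow> 'a \<Rightarrow> real"
    and Env :: "nat \<Rightarrow> 'a \<Rightarrow> real"
    and n N :: nat and p Mb l :: real
  assumes n_pos: "n \<ge> 1" and N_pos: "N \<ge> 1"
    and prob: "\<And>i. i \<in> {1..n} \<Longrightarrow> prob_space (M i)"
    and meas: "\<And>i j. i \<in> {1..n} \<Longrightarrow> j \<in> {1..N} \<Longrightarrow> Zf i j \<in> borel_measurable (M i)"
    and env_meas: "\<And>i. i \<in> {1..n} \<Longrightarrow> Env i \<in> borel_measurable (M i)"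
    and env: "\<And>i j x. i \<in> {1..n} \<Longrightarrow> j \<in> {1..N} \<Longrightarrow> x \<in> space (M i) \<Longrightarrow> \<bar>Zf i j x\<bar> \<le> Env i x"
    and p: "1 \<le> p" and Mb: "Mb > 0"
    and mom: "\<And>i. i \<in> {1..n} \<Longrightarrow>
       (\<integral>\<^sup>+ x. ennreal (\<bar>Env i x\<bar> powr p) \<partial>(M i)) \<le> ennreal (Mb powr p)"
    and l: "1 \<le> l" "l \<le> p"
    and sig_fin: "sigma_sq M Zf n N < \<infinity>"
  shows
   "(\<forall>\<epsilon>>0.
      (\<integral>\<^sup>+ w. ennreal (pos_pow (Zmax Zf n N w - (1 + \<epsilon>) *
            (\<integral>w'. Zmax Zf n N w' \<partial>(PiM {1..n} M))) l) \<partial>(PiM {1..n} M))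
      \<le> ennreal (((64 / \<epsilon> + 7 + \<epsilon>) * (l * Mb / real n powr (1 - l / p))
            + 4 * sqrt l * sqrt (enn2real (sigma_sq M Zf n N)) / sqrt (real n)) powr l))
    \<and> (\<forall>\<epsilon>. 0 < \<epsilon> \<and> \<epsilon> \<le> 1 \<longrightarrow>
      (\<integral>\<^sup>+ w. ennreal (pos_pow ((1 - \<epsilon>) * (\<integral>w'. Zmax Zf n N w' \<partial>(PiM {1..n} M))
            - Zmax Zf n N w) l) \<partial>(PiM {1..n} M))
      \<le> ennreal (((86.4 / \<epsilon> + 7 - \<epsilon>) * (l * Mb / real n powr (1 - l / p))
            + 4.7 * sqrt l * sqrt (enn2real (sigma_sq M Zf n N)) / sqrt (real n)) powr l))"
proof -
  \<comment> \<open>Outside \<open>{1..n}\<close> nothing is known about \<open>M\<close>, whereas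
    the product locale asks for a probability space at every index; \<open>M 1\<close> fills the
    gap, as \<open>n \<ge> 1\<close>.\<close>
  define M' where "M' i = (if i \<in> {1..n} then M i else M 1)" for i
  have M': "M' i = M i" if "i \<in> {1..n}" for i using that by (simp add: M'_def)
  have prob': "prob_space (M' i)" for i using prob n_pos by (simp add: M'_def)
  have PiM': "PiM {1..n} M' = PiM {1..n} M" by (rule PiM_cong) (simp_all add: M')
  have "(\<Sum>i\<in>{1..n}. \<integral>\<^sup>+ x. ennreal ((Zf i j x)\<^sup>2) \<partial>M' i)
      = (\<Sum>i\<in>{1..n}. \<integral>\<^sup>+ x. ennreal ((Zf i j x)\<^sup>2) \<partial>M i)" for j
    by (intro sum.cong refl) (simp only: M')
  then have sigma': "sigma_sq M' Zf n N = sigma_sq M Zf n N"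
    unfolding sigma_sq_def by (simp only:)
  note aux = Zmax_concentration[where M=M' and Zf=Zf and Env=Env and n=n and N=N and p=p and Mb=Mb and l=l,
      unfolded PiM' sigma', OF n_pos N_pos prob' _ _ _ p Mb _ l sig_fin]
  show ?thesis
  proof (intro conjI allI impI, goal_cases)
    case (1 \<epsilon>)
    show ?case by (rule aux(1)) (simp_all only: M' meas env_meas env mom 1)
  next
    case (2 \<epsilon>)
    show ?case by (rule aux(2)) (simp_all only: M' meas env_meas env mom 2)
  qed
qed

end
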